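(* Let $G$ be a connected graph with maximum degree $\Delta(G) \geq 4$ which is not a complete graph, and let $P \subseteq V(G)$ be a subset of vertices. Let $L$ be a list assignment for $G$ such that $|L(v)| \geq \Delta(G)$ for every $v \in V(G)\setminus P$. Suppose that at least one of the following holds: (i) $|L(v)| \geq 2$ for every $v \in P$, and any two distinct vertices of $P$ are at distance at least $4$ in $G$; or (ii) $|L(v)| \geq 3$ for every $v \in P$, and any two distinct vertices of $P$ are at distance at least $3$ in $G$. Then $G$ is $L$-colorable.
   Context: Graphs are finite and simple. A list assignment $L$ for $G$ assigns to each vertex $v$ of $G$ a set $L(v)$ of colors (positive integers). An $L$-coloring is a proper vertex coloring $\varphi$ of $G$ with $\varphi(v)\in L(v)$ for all $v \in V(G)$; $G$ is $L$-colorable if such a coloring exists. Distance is the length (number of edges) of a shortest path. *)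

theory Defs
  imports "Graph_Theory.Graph_Theory" "HOL-Library.Extended_Nat"
begin

text \<open>
  Finite simple graphs are the symmetric, loop-free digraphs without parallel arcs of the locale
  \<^locale>\<open>graph\<close>: each undirected edge is a pair of opposite arcs. Hence the out-degree of a
  vertex is its number of neighbours.
\<close>

definition max_degree :: "('a, 'b) pre_digraph \<Rightarrow> nat" where
  "max_degree G = Max (out_degree G ` verts G)"

definition complete_graph :: "('a, 'b) pre_digraph \<Rightarrow> bool" where
  "complete_graph G \<longleftrightarrow> (\<exists>n. complete_digraph n G)"

text \<open>
  With unit weights the cost of a walk is its number of arcs, so this is the length of a shortest
  path (and \<open>\<infinity>\<close> if there is none).
\<close>

definition graph_dist :: "('a, 'b) pre_digraph \<Rightarrow> 'a \<Rightarrow> 'a \<Rightarrow> ereal" where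
  "graph_dist G u v = wf_digraph.\<mu> G (\<lambda>_. 1) u v"

text \<open>
  Lists of colours are not required to be finite; since \<^const>\<open>card\<close> is 0 on infinite sets, list
  sizes are measured in \<^typ>\<open>enat\<close>.
\<close>

definition ecard :: "'c set \<Rightarrow> enat" where
  "ecard A = (if finite A then enat (card A) else \<infinity>)"

definition list_assignment :: "('a, 'b) pre_digraph \<Rightarrow> ('a \<Rightarrow> nat set) \<Rightarrow> bool" where
  "list_assignment G L \<longleftrightarrow> (\<forall>v \<in> verts G. L v \<subseteq> {1..})"

definition proper_coloring :: "('a, 'b) pre_digraph \<Rightarrow> ('a \<Rightarrow> nat) \<Rightarrow> bool" where
  "proper_coloring G \<phi> \<longleftrightarrow> (\<forall>u v. u \<rightarrow>\<^bsub>G\<^esub> v \<longrightarrow> \<phi> u \<noteq> \<phi> v)"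

definition L_coloring ::
  "('a, 'b) pre_digraph \<Rightarrow> ('a \<Rightarrow> nat set) \<Rightarrow> ('a \<Rightarrow> nat) \<Rightarrow> bool" where
  "L_coloring G L \<phi> \<longleftrightarrow> proper_coloring G \<phi> \<and> (\<forall>v \<in> verts G. \<phi> v \<in> L v)"

definition L_colorable :: "('a, 'b) pre_digraph \<Rightarrow> ('a \<Rightarrow> nat set) \<Rightarrow> bool" where
  "L_colorable G L \<longleftrightarrow> (\<exists>\<phi>. L_coloring G L \<phi>)"

end

theory Submission
  imports Defs
begin

text \<open>
  Colour \<open>P\<close> first. Every other vertex has at most one neighbour in \<open>P\<close>, so in \<open>G - P\<close> each
  remaining list is at least as large as the degree. A component that still cannot be coloured is
  tight, and by Brooks' theorem its end blocks are copies of \<open>K\<close> of order \<open>\<Delta>\<close> all of whose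
  vertices except the cut vertex \<open>x\<close> have a neighbour in \<open>P\<close>. If these neighbours all equal
  \<open>p\<close>, call the block a gadget; the block together with \<open>p\<close> is then \<open>K\<close> of order \<open>\<Delta> + 1\<close> minus
  the edge \<open>p x\<close>, so \<open>p\<close> and \<open>x\<close> have at most one further edge each.

  Lists of size 3 on \<open>P\<close>: a gadget can be deleted, since a colouring of the rest always extends.
  Without gadgets, each bad component has two adjacent vertices with distinct neighbours \<open>p\<close>,
  \<open>p'\<close> in \<open>P\<close>, where the colour of one of \<open>p\<close>, \<open>p'\<close> has at most one conflicting colour at the
  other. Counting edges, Hall's theorem lets distinct components choose distinct \<open>p\<close>; the
  resulting graph of conflicts on \<open>P\<close> is 2-degenerate, hence 3 colours suffice.

  Lists of size 2 on \<open>P\<close>: all end blocks are gadgets. Either \<open>p\<close> has a colour for which the gadget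
  never causes trouble, or \<open>p\<close> and \<open>x\<close> may safely share any colour of \<open>p\<close>. In the latter case
  replace the gadget by the single vertex \<open>p = x\<close> of degree at most 2. A tight component of the
  reduced graph would have an end block that is either a clique, hence a gadget again, or a cycle
  through two of the new vertices, which would put two vertices of \<open>P\<close> at distance 2.
\<close>

section \<open>Greedy colorings\<close>

locale simple_graph =
  fixes E :: "'a \<Rightarrow> 'a \<Rightarrow> bool"
  assumes sym: "E u v \<Longrightarrow> E v u"
    and irrefl: "\<not> E u u"
begin

definition nbhd :: "'a set \<Rightarrow> 'a \<Rightarrow> 'a set" where
  "nbhd S v = {u \<in> S. E v u}"

text \<open>These sets are the unions of components of the subgraph induced by \<open>S\<close>.
  Connectivity is expressed through them rather than through paths, and the empty set counts as
  connected.\<close>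

definition closed_in :: "'a set \<Rightarrow> 'a set \<Rightarrow> bool" where
  "closed_in S X \<longleftrightarrow> X \<subseteq> S \<and> (\<forall>u \<in> X. \<forall>v \<in> S. E u v \<longrightarrow> v \<in> X)"

definition conn :: "'a set \<Rightarrow> bool" where
  "conn S \<longleftrightarrow> (\<forall>X. closed_in S X \<longrightarrow> X \<noteq> {} \<longrightarrow> X = S)"

definition clique :: "'a set \<Rightarrow> bool" where
  "clique S \<longleftrightarrow> (\<forall>u \<in> S. \<forall>v \<in> S. u \<noteq> v \<longrightarrow> E u v)"

definition colors :: "'a set \<Rightarrow> ('a \<Rightarrow> 'c set) \<Rightarrow> ('a \<Rightarrow> 'c) \<Rightarrow> bool" where
  "colors S L \<phi> \<longleftrightarrow> (\<forall>v \<in> S. \<phi> v \<in> L v) \<and> (\<forall>u \<in> S. \<forall>v \<in> S. E u v \<longrightarrow> \<phi> u \<noteq> \<phi> v)"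

definition colorable :: "'a set \<Rightarrow> ('a \<Rightarrow> 'c set) \<Rightarrow> bool" where
  "colorable S L \<longleftrightarrow> (\<exists>\<phi>. colors S L \<phi>)"

lemma in_nbhd [simp]: "u \<in> nbhd S v \<longleftrightarrow> u \<in> S \<and> E v u"
  by (simp add: nbhd_def)

lemma finite_nbhd [simp]: "finite S \<Longrightarrow> finite (nbhd S v)"
  by (simp add: nbhd_def)

lemma nbhd_mono: "S \<subseteq> T \<Longrightarrow> nbhd S v \<subseteq> nbhd T v"
  by auto

lemma card_nbhd_mono: "finite T \<Longrightarrow> S \<subseteq> T \<Longrightarrow> card (nbhd S v) \<le> card (nbhd T v)"
  by (intro card_mono nbhd_mono) auto

lemma closed_inI:
  "X \<subseteq> S \<Longrightarrow> (\<And>u v. u \<in> X \<Longrightarrow> v \<in> S \<Longrightarrow> E u v \<Longrightarrow> v \<in> X) \<Longrightarrow> closed_in S X"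
  by (auto simp: closed_in_def)

lemma closed_inD: "closed_in S X \<Longrightarrow> u \<in> X \<Longrightarrow> v \<in> S \<Longrightarrow> E u v \<Longrightarrow> v \<in> X"
  by (auto simp: closed_in_def)

lemma closed_in_subset: "closed_in S X \<Longrightarrow> X \<subseteq> S"
  by (auto simp: closed_in_def)

lemma closed_in_diff: "closed_in S X \<Longrightarrow> closed_in S (S - X)"
  by (rule closed_inI) (auto dest: closed_inD sym)

lemma connD: "conn S \<Longrightarrow> closed_in S X \<Longrightarrow> X \<noteq> {} \<Longrightarrow> X = S"
  by (auto simp: conn_def)

lemma conn_side:
  assumes "\<not> conn S" "t \<in> S"
  obtains X where "closed_in S X" "X \<noteq> {}" "t \<notin> X"
proof -
  from assms(1) obtain X where X: "closed_in S X" "X \<noteq> {}" "X \<noteq> S"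
    by (auto simp: conn_def)
  then have "S - X \<noteq> {}"
    using closed_in_subset by blast
  then show thesis
    using that X closed_in_diff[OF X(1)] by (cases "t \<in> X") auto
qed

lemma conn_clique:
  assumes "clique S"
  shows "conn S"
  unfolding conn_def
proof (intro allI impI)
  fix X assume X: "closed_in S X" "X \<noteq> {}"
  then obtain u where u: "u \<in> X" "u \<in> S" using closed_in_subset by blast
  have "v \<in> X" if "v \<in> S" for v
    using closed_inD[OF X(1) u(1) that] assms u that by (cases "v = u") (auto simp: clique_def)
  then show "X = S" using closed_in_subset[OF X(1)] by blast
qed

lemma clique_subset: "clique T \<Longrightarrow> S \<subseteq> T \<Longrightarrow> clique S"
  by (auto simp: clique_def)

lemma nbhd_clique: "clique S \<Longrightarrow> v \<in> S \<Longrightarrow> nbhd S v = S - {v}"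
  using irrefl by (fastforce simp: clique_def)

text \<open>Removing the colours seen in \<open>U\<close> from the lists on \<open>D\<close> rules
  out every conflict across the two sets. Agreement of \<open>\<psi>\<close> with
  \<open>\<phi>\<close> on \<open>U\<close> lets later extensions keep colours chosen
  earlier.\<close>

lemma extend_colors:
  assumes "colors U L \<phi>" "U \<inter> D = {}" "colorable D (\<lambda>v. L v - \<phi> ` nbhd U v)"
  obtains \<psi> where "colors (U \<union> D) L \<psi>" "\<And>v. v \<in> U \<Longrightarrow> \<psi> v = \<phi> v"
proof -
  obtain \<chi> where \<chi>: "colors D (\<lambda>v. L v - \<phi> ` nbhd U v) \<chi>"
    using assms(3) by (auto simp: colorable_def)
  let ?\<psi> = "\<lambda>v. if v \<in> U then \<phi> v else \<chi> v"
  have \<chi>\<phi>: "\<chi> v \<noteq> \<phi> u" if "v \<in> D" "u \<in> U" "E v u" for u v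
    using \<chi> that by (auto simp: colors_def)
  have "colors (U \<union> D) L ?\<psi>"
    unfolding colors_def
  proof (intro conjI ballI impI)
    fix v assume "v \<in> U \<union> D"
    then show "?\<psi> v \<in> L v"
      using assms(1) \<chi> by (auto simp: colors_def)
  next
    fix u v assume uv: "u \<in> U \<union> D" "v \<in> U \<union> D" "E u v"
    then show "?\<psi> u \<noteq> ?\<psi> v"
      using assms(1) \<chi> \<chi>\<phi>[of u v] \<chi>\<phi>[of v u] sym[OF uv(3)] by (auto simp: colors_def)
  qed
  then show thesis
    using that[of ?\<psi>] by auto
qed

lemma colorable_extend:
  assumes "colors U L \<phi>" "U \<inter> D = {}" "colorable D (\<lambda>v. L v - \<phi> ` nbhd U v)"
  shows "colorable (U \<union> D) L"
  using extend_colors[OF assms] by (metis colorable_def)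

lemma colorable_insert:
  assumes "v \<notin> U" "c \<in> L v" "colorable U (\<lambda>u. if E v u then L u - {c} else L u)"
  shows "colorable (insert v U) L"
proof -
  have "colorable ({v} \<union> U) L"
  proof (rule colorable_extend)
    show "colors {v} L (\<lambda>_. c)"
      using assms(2) irrefl by (auto simp: colors_def)
    have "(L u - (\<lambda>_. c) ` nbhd {v} u) = (if E v u then L u - {c} else L u)" for u
      using sym[of v u] sym[of u v] by auto
    then show "colorable U (\<lambda>u. L u - (\<lambda>_. c) ` nbhd {v} u)"
      using assms(3) by presburger
  qed (use assms(1) in auto)
  then show ?thesis by simp
qed

lemma nbhd_remove: "nbhd (S - {r}) v = nbhd S v - {r}"
  by auto

text \<open>
  Colour a vertex with a spare colour last: deleting it leaves a spare colour at each of its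
  neighbours, so the hypothesis is inherited.
\<close>

lemma greedy:
  assumes "finite S"
    and "\<And>v. v \<in> S \<Longrightarrow> card (nbhd S v) \<le> card (L v)"
    and "\<And>X. closed_in S X \<Longrightarrow> X \<noteq> {} \<Longrightarrow> \<exists>v \<in> X. card (nbhd S v) < card (L v)"
  shows "colorable S L"
  using assms
proof (induction "card S" arbitrary: S)
  case 0
  then show ?case by (auto simp: colorable_def colors_def)
next
  case (Suc n)
  have "closed_in S S" "S \<noteq> {}"
    using Suc.hyps(2) by (auto simp: closed_in_def)
  then obtain r where r: "r \<in> S" "card (nbhd S r) < card (L r)"
    using Suc.prems(3) by blast
  let ?S = "S - {r}"
  have less: "card (nbhd ?S v) < card (L v)" if "v \<in> S" "E v r" for v
  proof -
    have "card (nbhd ?S v) < card (nbhd S v)"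
      unfolding nbhd_remove using that r(1) Suc.prems(1) by (intro card_Diff1_less) auto
    then show ?thesis using Suc.prems(2)[OF that(1)] by simp
  qed
  have le: "card (nbhd ?S v) \<le> card (nbhd S v)" for v
    using Suc.prems(1) by (intro card_nbhd_mono) auto
  have "colorable ?S L"
  proof (rule Suc.hyps(1))
    fix X assume X: "closed_in ?S X" "X \<noteq> {}"
    show "\<exists>v \<in> X. card (nbhd ?S v) < card (L v)"
    proof (cases "\<exists>v \<in> X. E v r")
      case True
      then show ?thesis using less X(1) closed_in_subset by blast
    next
      case False
      then have "closed_in S X"
        using X(1) by (intro closed_inI) (auto dest: closed_inD closed_in_subset)
      then show ?thesis
        using Suc.prems(3) X(2) le le_less_trans by blast
    qed
  next
    fix v assume "v \<in> ?S"
    then show "card (nbhd ?S v) \<le> card (L v)"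
      using Suc.prems(2) le le_trans by blast
  qed (use Suc.hyps(2) Suc.prems(1) r(1) in auto)
  then obtain \<phi> where \<phi>: "colors ?S L \<phi>" by (auto simp: colorable_def)
  have "card (\<phi> ` nbhd ?S r) \<le> card (nbhd ?S r)"
    using Suc.prems(1) by (intro card_image_le) auto
  then have lt: "card (\<phi> ` nbhd ?S r) < card (L r)"
    using le[of r] r(2) by linarith
  have "\<not> L r \<subseteq> \<phi> ` nbhd ?S r"
  proof
    assume "L r \<subseteq> \<phi> ` nbhd ?S r"
    then have "card (L r) \<le> card (\<phi> ` nbhd ?S r)"
      using Suc.prems(1) by (intro card_mono) auto
    then show False using lt by simp
  qed
  then have "colorable {r} (\<lambda>v. L v - \<phi> ` nbhd ?S v)"
    using irrefl by (auto simp: colorable_def colors_def)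
  then have "colorable (?S \<union> {r}) L"
    by (intro colorable_extend[OF \<phi>]) auto
  then show ?case using r(1) by (simp add: insert_absorb)
qed

lemma greedy_conn:
  assumes "finite S" "conn S" "r \<in> S" "card (nbhd S r) < card (L r)"
    and "\<And>v. v \<in> S \<Longrightarrow> card (nbhd S v) \<le> card (L v)"
  shows "colorable S L"
  using assms by (intro greedy) (auto dest: connD)

text \<open>Giving \<open>u\<close> the colour \<open>c\<close> costs \<open>v\<close> a neighbour
  but no colour. So \<open>v\<close> has a spare colour in the connected set \<open>S - {u}\<close>,
  while every other vertex loses at most as many colours as neighbours.\<close>

lemma greedy_two_lists:
  assumes "finite S" "conn (S - {u})" "u \<in> S" "v \<in> S" "E u v" "c \<in> L u" "c \<notin> L v"
    and deg: "\<And>w. w \<in> S \<Longrightarrow> card (nbhd S w) \<le> card (L w)"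
    and fin: "\<And>w. w \<in> S \<Longrightarrow> finite (L w)"
  shows "colorable S L"
proof -
  let ?L = "\<lambda>w. if E u w then L w - {c} else L w"
  have uv: "u \<noteq> v" using assms(5) irrefl by auto
  have nb: "card (nbhd (S - {u}) w) = card (nbhd S w) - 1" if "E u w" for w
  proof -
    have "u \<in> nbhd S w" using that assms(3) sym by simp
    then show ?thesis by (simp add: nbhd_remove)
  qed
  have "colorable (S - {u}) ?L"
  proof (rule greedy_conn[where r = v])
    have "u \<in> nbhd S v" using assms(3,5) sym by simp
    then have "nbhd S v \<noteq> {}" by blast
    then have "card (nbhd S v) > 0" using assms(1) by (simp add: card_gt_0_iff)
    then show "card (nbhd (S - {u}) v) < card (?L v)"
      using nb[OF assms(5)] deg[OF assms(4)] assms(5,7) by simp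
  next
    fix w assume w: "w \<in> S - {u}"
    show "card (nbhd (S - {u}) w) \<le> card (?L w)"
    proof (cases "E u w")
      case True
      have "card (L w) - 1 \<le> card (L w - {c})"
        using fin w by (cases "c \<in> L w") auto
      then show ?thesis using nb[OF True] deg[of w] w True by simp
    next
      case False
      then have "nbhd (S - {u}) w = nbhd S w" using sym by auto
      then show ?thesis using False deg[of w] w by simp
    qed
  qed (use assms uv in auto)
  then have "colorable (insert u (S - {u})) L"
    by (intro colorable_insert[of u _ c]) (use assms(6) in auto)
  then show ?thesis using assms(3) by (simp add: insert_absorb)
qed

section \<open>Components of graphs that cannot be coloured\<close>

lemma noncolorable_component:
  assumes "finite S" "\<not> colorable S L"
  obtains H where "closed_in S H" "H \<noteq> {}" "conn H" "\<not> colorable H L"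
proof -
  have "\<exists>H. closed_in S H \<and> H \<noteq> {} \<and> conn H \<and> \<not> colorable H L"
    using assms
  proof (induction "card S" arbitrary: S rule: less_induct)
    case less
    have ne: "S \<noteq> {}" using less.prems(2) by (auto simp: colorable_def colors_def)
    show ?case
    proof (cases "conn S")
      case True
      then show ?thesis using less.prems(2) ne by (intro exI[of _ S]) (auto simp: closed_in_def)
    next
      case False
      then obtain X where X: "closed_in S X" "X \<noteq> {}" "X \<noteq> S" by (auto simp: conn_def)
      have sub: "X \<subseteq> S" using X(1) closed_in_subset by blast
      have "\<not> colorable X L \<or> \<not> colorable (S - X) L"
      proof (rule ccontr)
        assume "\<not> ?thesis"
        then obtain \<phi> where \<phi>: "colors X L \<phi>" and c: "colorable (S - X) L"
          by (auto simp: colorable_def)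
        have "colorable (S - X) (\<lambda>v. L v - \<phi> ` nbhd X v)"
        proof -
          obtain \<psi> where "colors (S - X) L \<psi>" using c by (auto simp: colorable_def)
          moreover have "nbhd X v = {}" if "v \<in> S - X" for v
            using X(1) that closed_inD sym by fastforce
          ultimately have "colors (S - X) (\<lambda>v. L v - \<phi> ` nbhd X v) \<psi>"
            by (simp add: colors_def)
          then show ?thesis by (auto simp: colorable_def)
        qed
        from colorable_extend[OF \<phi> _ this] have "colorable (X \<union> (S - X)) L" by auto
        then show False using less.prems(2) sub by (simp add: Un_absorb1)
      qed
      then obtain Y where Y: "closed_in S Y" "Y \<noteq> S" "\<not> colorable Y L"
        using X closed_in_diff[OF X(1)] sub by blast
      have Ysub: "Y \<subseteq> S" using Y(1) closed_in_subset by blast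
      have "card Y < card S"
        using Y(2) Ysub less.prems(1) by (simp add: psubset_card_mono psubsetI)
      then obtain H where H: "closed_in Y H" "H \<noteq> {}" "conn H" "\<not> colorable H L"
        using less.hyps[of Y] Y(3) Ysub less.prems(1) finite_subset by metis
      have "closed_in S H"
        using H(1) Y(1) by (intro closed_inI) (meson closed_inD closed_in_subset subset_iff)+
      then show ?thesis using H by blast
    qed
  qed
  then show thesis using that by blast
qed

lemma components_eq:
  assumes "closed_in S X" "conn X" "closed_in S Y" "conn Y" "X \<inter> Y \<noteq> {}"
  shows "X = Y"
proof -
  have "closed_in X (X \<inter> Y)" "closed_in Y (X \<inter> Y)"
    using assms(1,3) by (auto simp: closed_in_def)
  then show ?thesis
    using assms connD by metis
qed

section \<open>End blocks and the theorem of Brooks\<close>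


text \<open>The only exit from \<open>X\<close> within \<open>T\<close> is \<open>t\<close>. Since
  \<open>t\<close> may also lie in \<open>X\<close>, sets closed in \<open>T\<close> are covered as
  well.\<close>

definition attached :: "'a set \<Rightarrow> 'a set \<Rightarrow> 'a \<Rightarrow> bool" where
  "attached T X t \<longleftrightarrow> (\<forall>u \<in> X. \<forall>v \<in> T. E u v \<longrightarrow> v \<in> insert t X)"

text \<open>
  An end block with cut vertex \<open>x\<close>, encoded by the set \<open>W\<close> of its remaining vertices: an
  inclusion-minimal set whose only outside neighbour is a single vertex.
\<close>

definition leaf :: "'a set \<Rightarrow> 'a \<Rightarrow> 'a set \<Rightarrow> bool" where
  "leaf T x W \<longleftrightarrow> W \<subseteq> T \<and> W \<noteq> {} \<and> x \<in> T - W \<and> attached T W x \<and>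
    (\<forall>X t. X \<subset> W \<longrightarrow> X \<noteq> {} \<longrightarrow> \<not> attached T X t)"

text \<open>Take a nonempty attached subset of \<open>W0\<close> of least cardinality. If its
  attaching vertex were not in \<open>T - W\<close>, the set would be closed in the connected
  \<open>T\<close>, hence all of \<open>T\<close>.\<close>

lemma leaf_exists:
  assumes "finite T" "conn T" "W0 \<subseteq> T" "W0 \<noteq> {}" "W0 \<noteq> T" "attached T W0 x0"
  obtains x W where "W \<subseteq> W0" "leaf T x W"
proof -
  let ?P = "\<lambda>W. W \<subseteq> W0 \<and> W \<noteq> {} \<and> (\<exists>t. attached T W t)"
  have "?P W0" using assms by auto
  then obtain W where W: "?P W" "\<And>W'. ?P W' \<Longrightarrow> card W \<le> card W'"
    using ex_has_least_nat[of ?P W0 card] by blast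
  then obtain x where x: "attached T W x" by blast
  have sub: "W \<subseteq> T" using W(1) assms(3) by blast
  have finW: "finite W" using finite_subset[OF sub assms(1)] .
  have "x \<in> T - W"
  proof (rule ccontr)
    assume "x \<notin> T - W"
    then have "closed_in T W"
      using x sub unfolding closed_in_def attached_def by blast
    then have "W = T" using connD[OF assms(2)] W(1) by blast
    then show False using W(1) assms(3,5) by auto
  qed
  moreover have "\<not> attached T X t" if "X \<subset> W" "X \<noteq> {}" for X t
  proof
    assume "attached T X t"
    then have "?P X" using that W(1) by blast
    then show False using W(2)[of X] psubset_card_mono[OF finW that(1)] by simp
  qed
  ultimately have "leaf T x W" using W(1) sub x unfolding leaf_def by blast
  then show thesis using that W(1) by blast
qed

lemma leafD:
  assumes "leaf T x W"
  shows "W \<subseteq> T" "W \<noteq> {}" "x \<in> T" "x \<notin> W" "attached T W x"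
  using assms by (simp_all add: leaf_def)

lemma leaf_minimal: "leaf T x W \<Longrightarrow> X \<subset> W \<Longrightarrow> X \<noteq> {} \<Longrightarrow> attached T X t \<Longrightarrow> False"
  by (simp add: leaf_def)

lemma leaf_nbr: "leaf T x W \<Longrightarrow> u \<in> W \<Longrightarrow> v \<in> T \<Longrightarrow> E u v \<Longrightarrow> v \<in> insert x W"
  using leafD(5) by (simp add: attached_def)

lemma leaf_subset: "leaf T x W \<Longrightarrow> insert x W \<subseteq> T"
  by (simp add: leafD)

text \<open>A piece of the block cut off by deleting \<open>t\<close>, chosen so as to avoid
  \<open>x\<close>, would be a smaller set attached to \<open>t\<close>, against the minimality of
  \<open>W\<close>.\<close>

lemma leaf_block_conn:
  assumes "leaf T x W" "t \<in> insert x W"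
  shows "conn (insert x W - {t})"
proof (rule ccontr)
  assume nc: "\<not> conn (insert x W - {t})"
  have xW: "x \<notin> W" using leafD[OF assms(1)] by blast+
  show False
  proof (cases "t = x")
    case True
    then have "\<not> conn W" using nc xW by simp
    then obtain X where X: "closed_in W X" "X \<noteq> {}" "X \<noteq> W" by (auto simp: conn_def)
    have "attached T X x"
      unfolding attached_def
    proof (intro ballI impI)
      fix u v assume "u \<in> X" "v \<in> T" "E u v"
      then show "v \<in> insert x X"
        using leaf_nbr[OF assms(1), of u v] closed_in_subset[OF X(1)] closed_inD[OF X(1), of u v]
        by blast
    qed
    then show False
      using leaf_minimal[OF assms(1), of X] X closed_in_subset by blast
  next
    case False
    then have "x \<in> insert x W - {t}" by auto
    then obtain X where X: "closed_in (insert x W - {t}) X" "X \<noteq> {}" "x \<notin> X"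
      using conn_side[OF nc] by blast
    have sub: "X \<subseteq> W - {t}" using X closed_in_subset by fastforce
    have "attached T X t"
      unfolding attached_def
    proof (intro ballI impI)
      fix u v assume "u \<in> X" "v \<in> T" "E u v"
      then show "v \<in> insert t X"
        using leaf_nbr[OF assms(1), of u v] sub closed_inD[OF X(1), of u v] by blast
    qed
    then show False
      using leaf_minimal[OF assms(1), of X] X sub assms(2) False by blast
  qed
qed

text \<open>Consider a piece of \<open>T - {v}\<close> that avoids \<open>x\<close>. If it meets
  \<open>W\<close>, its trace there is attached to \<open>v\<close> against minimality; if not, it
  is closed in \<open>T\<close>, because all neighbours of \<open>v\<close> lie in
  \<open>insert x W\<close>.\<close>

lemma leaf_remove_conn:
  assumes "leaf T x W" "conn T" "v \<in> W"
  shows "conn (T - {v})"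
proof (rule ccontr)
  assume nc: "\<not> conn (T - {v})"
  have xW: "x \<in> T - W" "W \<subseteq> T" using leafD[OF assms(1)] by blast+
  then obtain X where X: "closed_in (T - {v}) X" "X \<noteq> {}" "x \<notin> X"
    using conn_side[OF nc, of x] assms(3) by auto
  have sub: "X \<subseteq> T - {v}" using X closed_in_subset by blast
  show False
  proof (cases "X \<inter> W = {}")
    case False
    have "attached T (X \<inter> W) v"
      unfolding attached_def
    proof (intro ballI impI)
      fix u y assume "u \<in> X \<inter> W" "y \<in> T" "E u y"
      then show "y \<in> insert v (X \<inter> W)"
        using leaf_nbr[OF assms(1), of u y] X closed_inD[OF X(1), of u y] by auto
    qed
    then show False
      using leaf_minimal[OF assms(1), of "X \<inter> W"] False sub assms(3) by blast
  next
    case True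
    have "closed_in T X"
    proof (rule closed_inI)
      fix u y assume u: "u \<in> X" "y \<in> T" "E u y"
      show "y \<in> X"
      proof (cases "y = v")
        case True
        then have "u \<in> insert x W"
          using leaf_nbr[OF assms(1) assms(3), of u] u sub sym by auto
        then show ?thesis using u X(3) \<open>X \<inter> W = {}\<close> by auto
      next
        case False
        then show ?thesis using closed_inD[OF X(1), of u y] u by auto
      qed
    qed (use sub in auto)
    then show False using connD[OF assms(2)] X(2) sub assms(3) xW(2) by blast
  qed
qed

section \<open>Brooks' theorem for regular graphs without cut vertices\<close>

lemma conn_insert:
  assumes "conn S" "y \<in> S" "E a y"
  shows "conn (insert a S)"
  unfolding conn_def
proof (intro allI impI)
  fix X assume X: "closed_in (insert a S) X" "X \<noteq> {}"
  have "y \<in> X"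
  proof (cases "X \<inter> S = {}")
    case True
    then have "a \<in> X" using X closed_in_subset by blast
    then show ?thesis using closed_inD[OF X(1), of a y] assms by auto
  next
    case False
    have "closed_in S (X \<inter> S)" using X(1) by (auto simp: closed_in_def)
    then show ?thesis using connD[OF assms(1)] False assms(2) by blast
  qed
  then have "X \<inter> S \<noteq> {}" "a \<in> X"
    using assms closed_inD[OF X(1), of y a] sym by auto
  moreover have "closed_in S (X \<inter> S)" using X(1) by (auto simp: closed_in_def)
  ultimately show "X = insert a S"
    using connD[OF assms(1)] closed_in_subset[OF X(1)] by blast
qed

text \<open>This is the triple from Lovasz's proof of Brooks' theorem. If no pair of vertices
  disconnects \<open>S\<close>, any induced path with two edges will do. Otherwise some
  \<open>S - {a}\<close> has a cut vertex, and \<open>v\<close> and \<open>w\<close> are neighbours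
  of \<open>a\<close> in different end blocks of it.\<close>

lemma brooks_triple:
  assumes fin: "finite S" and two: "\<And>t. t \<in> S \<Longrightarrow> conn (S - {t})"
    and deg: "\<And>v. v \<in> S \<Longrightarrow> 3 \<le> card (nbhd S v)" and "\<not> clique S"
  obtains u v w where "u \<in> S" "v \<in> S" "w \<in> S" "v \<noteq> w" "\<not> E v w" "E u v" "E u w" "conn (S - {v, w})"
proof -
  obtain a0 z where az: "a0 \<in> S" "z \<in> S" "a0 \<noteq> z" "\<not> E a0 z"
    using assms(4) by (auto simp: clique_def)
  have "nbhd S a0 \<noteq> {}" using deg[OF az(1)] by auto
  then obtain y0 where "y0 \<in> nbhd S a0" by blast
  then have "y0 \<in> S - {a0}" "E a0 y0" using irrefl[of a0] by auto
  then have "conn S"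
    using conn_insert[OF two[OF az(1)]] az(1) by (metis insert_Diff)
  show thesis
  proof (cases "\<forall>a \<in> S. \<forall>t \<in> S. conn (S - {a, t})")
    case True
    let ?X = "insert a0 (nbhd S a0)"
    \<comment> \<open>The nonneighbour \<open>z\<close> lies outside the closed neighbourhood of
      \<open>a0\<close>, so some edge leaves that set; its inner end is a neighbour of
      \<open>a0\<close>, and its outer end is not.\<close>
    have "\<not> closed_in S ?X"
      using connD[OF \<open>conn S\<close>, of ?X] az by (metis in_nbhd insertE insert_not_empty)
    moreover have "?X \<subseteq> S" using az(1) by auto
    ultimately obtain u b where "u \<in> ?X" "b \<in> S" "E u b" "b \<notin> ?X"
      unfolding closed_in_def by blast
    then show thesis
      using that[of u a0 b] az True sym by auto
  next
    case False
    then obtain a t where at: "a \<in> S" "t \<in> S" "\<not> conn (S - {a, t})" by blast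
    let ?T = "S - {a}"
    have eq: "S - {a, t} = ?T - {t}" by auto
    have cT: "conn ?T" using two at by blast
    have ta: "t \<noteq> a" using cT at(3) by auto
    obtain X where X: "closed_in (?T - {t}) X" "X \<noteq> {}" "X \<noteq> ?T - {t}"
      using at(3) unfolding eq conn_def by blast
    define Y where "Y = ?T - {t} - X"
    have Xs: "X \<subseteq> ?T - {t}" using X(1) closed_in_subset by blast
    have Y: "closed_in (?T - {t}) Y" "Y \<noteq> {}" "Y \<subseteq> ?T - {t}"
      using closed_in_diff[OF X(1)] X(3) Xs by (auto simp: Y_def)
    have XY: "\<not> E p q" if "p \<in> X" "q \<in> Y" for p q
      using closed_inD[OF X(1) that(1), of q] that(2) by (auto simp: Y_def)
    have attX: "attached ?T X t"
      using X(1) unfolding attached_def closed_in_def by blast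
    have "finite ?T" "X \<subseteq> ?T" "X \<noteq> ?T" using fin Xs ta at(2) by auto
    then obtain x1 W1 where W1: "W1 \<subseteq> X" "leaf ?T x1 W1"
      by (rule leaf_exists[OF _ cT _ X(2) _ attX])
    \<comment> \<open>Otherwise \<open>x1\<close> alone would separate \<open>W1\<close> from
      \<open>a\<close> in \<open>S\<close>.\<close>
    have "\<exists>v \<in> W1. E a v"
    proof (rule ccontr)
      assume no: "\<not> ?thesis"
      have x1: "x1 \<in> ?T - W1" "W1 \<subseteq> ?T" "W1 \<noteq> {}" using leafD[OF W1(2)] by blast+
      have "closed_in (S - {x1}) W1"
      proof (rule closed_inI)
        fix u y assume uy: "u \<in> W1" "y \<in> S - {x1}" "E u y"
        then have "y \<noteq> a" using no sym by blast
        then show "y \<in> W1" using leaf_nbr[OF W1(2), of u y] uy by blast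
      qed (use x1 in auto)
      then have "W1 = S - {x1}" using connD two x1 by blast
      then show False using x1 at(1) by auto
    qed
    then obtain v where v: "v \<in> W1" "E a v" by blast
    have vX: "v \<in> X" using v(1) W1(1) by auto
    have cTv: "conn (?T - {v})" using leaf_remove_conn[OF W1(2) cT v(1)] .
    \<comment> \<open>The second end block is taken after deleting \<open>v\<close>, so that
      deleting \<open>v\<close> and then \<open>w\<close> keeps \<open>?T\<close> connected.\<close>
    have attY: "attached (?T - {v}) Y t"
      using Y(1) unfolding attached_def closed_in_def by blast
    have "finite (?T - {v})" "Y \<subseteq> ?T - {v}" "Y \<noteq> ?T - {v}"
      using fin Y(3) vX Xs ta at(2) by (auto simp: Y_def)
    then obtain x2 W2 where W2: "W2 \<subseteq> Y" "leaf (?T - {v}) x2 W2"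
      by (rule leaf_exists[OF _ cTv _ Y(2) _ attY])
    have "\<exists>w \<in> W2. E a w"
    proof (rule ccontr)
      assume no: "\<not> ?thesis"
      have x2: "x2 \<in> ?T - W2" "W2 \<subseteq> ?T - {v}" "W2 \<noteq> {}" using leafD[OF W2(2)] by blast+
      have "closed_in (S - {x2}) W2"
      proof (rule closed_inI)
        fix u y assume uy: "u \<in> W2" "y \<in> S - {x2}" "E u y"
        then have "y \<noteq> a" using no sym by blast
        moreover have "y \<noteq> v" using XY[OF vX, of u] uy W2(1) sym by blast
        ultimately show "y \<in> W2" using leaf_nbr[OF W2(2), of u y] uy by blast
      qed (use x2 in auto)
      then have "W2 = S - {x2}" using connD two x2 by blast
      then show False using x2 at(1) by auto
    qed
    then obtain w where w: "w \<in> W2" "E a w" by blast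
    have wY: "w \<in> Y" using w(1) W2(1) by auto
    have c: "conn (?T - {v} - {w})" using leaf_remove_conn[OF W2(2) cTv w(1)] .
    \<comment> \<open>Having degree at least three, \<open>a\<close> keeps a neighbour other than
      \<open>v\<close> and \<open>w\<close>, through which it is joined to the connected
      rest.\<close>
    have "card (nbhd S a) - card {v, w} \<le> card (nbhd S a - {v, w})"
      by (intro diff_card_le_card_Diff) auto
    moreover have "card {v, w} \<le> 2" by (simp add: card_insert_if)
    ultimately have "card (nbhd S a - {v, w}) \<noteq> 0" using deg[OF at(1)] by linarith
    then have "nbhd S a - {v, w} \<noteq> {}" by (metis card.empty)
    then obtain y where "y \<in> nbhd S a - {v, w}" by blast
    then have y: "y \<in> S" "E a y" "y \<noteq> v" "y \<noteq> w" by auto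
    then have "conn (insert a (?T - {v} - {w}))"
      using conn_insert[OF c, of y a] irrefl by auto
    moreover have "insert a (?T - {v} - {w}) = S - {v, w}"
      using v(2) w(2) irrefl at(1) by auto
    moreover have "v \<noteq> w" "\<not> E v w" "v \<in> S" "w \<in> S"
      using XY[OF vX wY] vX wY Xs by (auto simp: Y_def)
    ultimately show thesis using that[of a v w] at(1) v w by metis
  qed
qed

text \<open>The nonadjacent \<open>v\<close> and \<open>w\<close> receive the same colour. Their
  common neighbour \<open>u\<close> then loses two neighbours but one colour, and this spare colour
  suffices for the greedy argument on the connected remainder.\<close>

lemma brooks_2conn:
  assumes fin: "finite S" and two: "\<And>t. t \<in> S \<Longrightarrow> conn (S - {t})"
    and deg: "\<And>v. v \<in> S \<Longrightarrow> card (nbhd S v) = card A" and A: "3 \<le> card A" and "\<not> clique S"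
  shows "colorable S (\<lambda>_. A)"
proof -
  obtain u v w where uvw: "u \<in> S" "v \<in> S" "w \<in> S" "v \<noteq> w" "\<not> E v w" "E u v" "E u w"
      "conn (S - {v, w})"
    using brooks_triple[OF fin two] deg A assms(5) by metis
  have finA: "finite A" using A card.infinite by fastforce
  obtain c where c: "c \<in> A" using A by fastforce
  have "colorable ({v, w} \<union> (S - {v, w})) (\<lambda>_. A)"
  proof (rule colorable_extend)
    show "colors {v, w} (\<lambda>_. A) (\<lambda>_. c)"
      using c uvw(5) irrefl sym by (auto simp: colors_def)
    let ?L = "\<lambda>y. A - (\<lambda>_. c) ` nbhd {v, w} y"
    have lists: "card (?L y) = (if nbhd {v, w} y = {} then card A else card A - 1)" for y
      using c finA by (auto simp: image_constant_conv)
    have nb: "card (nbhd (S - {v, w}) y) = card A - card (nbhd {v, w} y)" if "y \<in> S" for y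
    proof -
      have "nbhd (S - {v, w}) y = nbhd S y - nbhd {v, w} y" by auto
      moreover have "nbhd {v, w} y \<subseteq> nbhd S y" using uvw by auto
      ultimately show ?thesis using deg[OF that] fin by (simp add: card_Diff_subset)
    qed
    show "colorable (S - {v, w}) ?L"
    proof (rule greedy_conn[where r = u])
      show "u \<in> S - {v, w}" using uvw irrefl by auto
      have "nbhd {v, w} u = {v, w}" using uvw by auto
      then show "card (nbhd (S - {v, w}) u) < card (?L u)"
        using nb[OF uvw(1)] lists[of u] uvw(4) A by simp
    next
      fix y assume "y \<in> S - {v, w}"
      then have eq: "card (nbhd (S - {v, w}) y) = card A - card (nbhd {v, w} y)" using nb by blast
      show "card (nbhd (S - {v, w}) y) \<le> card (?L y)"
      proof (cases "nbhd {v, w} y = {}")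
        case True
        then show ?thesis using eq lists[of y] by simp
      next
        case False
        then have "card (nbhd {v, w} y) > 0" by (simp add: card_gt_0_iff)
        then show ?thesis using eq lists[of y] False by presburger
      qed
    qed (use fin uvw in auto)
  qed auto
  moreover have "{v, w} \<union> (S - {v, w}) = S" using uvw by auto
  ultimately show ?thesis by simp
qed

section \<open>Uncolourable graphs whose lists are at least as large as the degrees\<close>

text \<open>Distinct lists at adjacent vertices allow a colouring by
  \<open>greedy_two_lists\<close>, and a spare colour allows one by \<open>greedy_conn\<close>. What
  is left is a regular graph with one common list, where Brooks' theorem applies.\<close>

lemma uniform_or_colorable:
  assumes fin: "finite S" and "conn S" "S \<noteq> {}" and two: "\<And>t. t \<in> S \<Longrightarrow> conn (S - {t})"
    and deg: "\<And>v. v \<in> S \<Longrightarrow> card (nbhd S v) \<le> card (L v)"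
    and finL: "\<And>v. v \<in> S \<Longrightarrow> finite (L v)" and nc: "\<not> colorable S L"
  obtains A where "\<And>v. v \<in> S \<Longrightarrow> L v = A" "\<And>v. v \<in> S \<Longrightarrow> card (nbhd S v) = card A"
    "3 \<le> card A \<Longrightarrow> clique S"
proof -
  have sub: "L u \<subseteq> L v" if "u \<in> S" "v \<in> S" "E u v" for u v
  proof (rule ccontr)
    assume "\<not> ?thesis"
    then obtain c where c: "c \<in> L u" "c \<notin> L v" by blast
    show False
      using greedy_two_lists[OF fin two[OF that(1)] that c deg finL] nc by simp
  qed
  obtain r where r: "r \<in> S" using assms(3) by blast
  let ?X = "{v \<in> S. L v = L r}"
  have "closed_in S ?X"
  proof (rule closed_inI)
    fix u v assume "u \<in> ?X" "v \<in> S" "E u v"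
    then show "v \<in> ?X" using sub[of u v] sub[of v u] sym[of u v] by auto
  qed auto
  then have X: "?X = S" using connD[OF assms(2), of ?X] r by blast
  have L: "L v = L r" if "v \<in> S" for v
    using that X by blast
  have tight: "card (nbhd S v) = card (L r)" if "v \<in> S" for v
    using greedy_conn[OF fin assms(2) that _ deg] deg[OF that] nc L[OF that]
    by (metis le_neq_implies_less)
  have "clique S" if "3 \<le> card (L r)"
  proof (rule ccontr)
    assume "\<not> clique S"
    then have "colorable S (\<lambda>_. L r)"
      using brooks_2conn[OF fin two tight that] by simp
    then show False using nc L by (auto simp: colorable_def colors_def)
  qed
  show thesis
    by (rule that[OF L tight]) (assumption, assumption, rule \<open>3 \<le> card (L r) \<Longrightarrow> clique S\<close>)
qed

text \<open>The part of \<open>H\<close> outside the end block can be coloured greedily: each of its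
  components contains a neighbour of \<open>x\<close>, which gains a spare colour. The block must
  then be uncolourable from the residual lists, and on \<open>W\<close> these are the original lists
  since only \<open>x\<close> has neighbours outside the block.\<close>

lemma tight_leaf:
  assumes fin: "finite H" and cH: "conn H"
    and deg: "\<And>v. v \<in> H \<Longrightarrow> card (nbhd H v) \<le> card (L v)"
    and finL: "\<And>v. v \<in> H \<Longrightarrow> finite (L v)" and nc: "\<not> colorable H L"
    and W0: "W0 \<subseteq> H" "W0 \<noteq> {}" "W0 \<noteq> H" "attached H W0 x0"
  obtains x W s where "W \<subseteq> W0" "leaf H x W"
    "\<And>v. v \<in> insert x W \<Longrightarrow> card (nbhd (insert x W) v) = s"
    "\<And>v. v \<in> W \<Longrightarrow> card (nbhd H v) = s" "\<And>v. v \<in> W \<Longrightarrow> card (L v) = s"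
    "3 \<le> s \<Longrightarrow> clique (insert x W)"
proof -
  obtain x W where W: "W \<subseteq> W0" "leaf H x W"
    by (rule leaf_exists[OF fin cH W0])
  let ?B = "insert x W"
  have BH: "?B \<subseteq> H" using leaf_subset[OF W(2)] .
  have x: "x \<in> H" "x \<notin> W" "W \<noteq> {}" using leafD[OF W(2)] by blast+
  have two: "conn (?B - {t})" if "t \<in> ?B" for t
    using leaf_block_conn[OF W(2) that] .
  have cW: "conn W" using two[of x] x by simp
  have "\<exists>y \<in> W. E x y"
  proof (rule ccontr)
    assume no: "\<not> ?thesis"
    have "closed_in H W"
    proof (rule closed_inI)
      fix u v assume uv: "u \<in> W" "v \<in> H" "E u v"
      then have "v \<noteq> x" using no sym[of u v] by auto
      then show "v \<in> W" using leaf_nbr[OF W(2) uv] by auto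
    qed (use BH in auto)
    then show False using connD[OF cH] x by blast
  qed
  then have cB: "conn ?B" using conn_insert[OF cW] by blast
  have "colorable (H - ?B) L"
  proof (rule greedy)
    fix X assume X: "closed_in (H - ?B) X" "X \<noteq> {}"
    have Xs: "X \<subseteq> H - ?B" using X(1) closed_in_subset by blast
    have "\<exists>u \<in> X. E u x"
    proof (rule ccontr)
      assume no: "\<not> ?thesis"
      have "closed_in H X"
      proof (rule closed_inI)
        fix u v assume uv: "u \<in> X" "v \<in> H" "E u v"
        have "v \<notin> W" using leaf_nbr[OF W(2), of v u] uv Xs sym[OF uv(3)] by auto
        moreover have "v \<noteq> x" using uv no by auto
        ultimately show "v \<in> X" using closed_inD[OF X(1), of u v] uv by auto
      qed (use Xs in auto)
      then show False using connD[OF cH] X(2) Xs x by blast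
    qed
    then obtain u where u: "u \<in> X" "E u x" by blast
    have "nbhd (H - ?B) u \<subset> nbhd H u" using u x by auto
    then have "card (nbhd (H - ?B) u) < card (nbhd H u)"
      using fin by (intro psubset_card_mono) auto
    then show "\<exists>v \<in> X. card (nbhd (H - ?B) v) < card (L v)"
      using deg[of u] u(1) Xs by force
  next
    fix v assume "v \<in> H - ?B"
    then show "card (nbhd (H - ?B) v) \<le> card (L v)"
      using deg[of v] card_nbhd_mono[OF fin, of "H - ?B" v] by auto
  qed (use fin in auto)
  then obtain \<phi> where \<phi>: "colors (H - ?B) L \<phi>" by (auto simp: colorable_def)
  define L' where "L' = (\<lambda>v. L v - \<phi> ` nbhd (H - ?B) v)"
  have L'W: "L' v = L v" "nbhd ?B v = nbhd H v" if "v \<in> W" for v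
  proof -
    have "nbhd (H - ?B) v = {}"
    proof (rule equals0I)
      fix y assume "y \<in> nbhd (H - ?B) v"
      then show False using leaf_nbr[OF W(2) that, of y] by auto
    qed
    then show "L' v = L v" by (simp add: L'_def)
    show "nbhd ?B v = nbhd H v" using leaf_nbr[OF W(2) that] BH by auto
  qed
  have nc': "\<not> colorable ?B L'"
  proof
    assume "colorable ?B L'"
    then have "colorable ((H - ?B) \<union> ?B) L"
      unfolding L'_def by (intro colorable_extend[OF \<phi>]) auto
    moreover have "(H - ?B) \<union> ?B = H" using BH by blast
    ultimately show False using nc by simp
  qed
  have deg': "card (nbhd ?B v) \<le> card (L' v)" if v: "v \<in> ?B" for v
  proof -
    have f: "finite (nbhd (H - ?B) v)" using fin by simp
    have "card (nbhd H v) = card (nbhd ?B v \<union> nbhd (H - ?B) v)"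
      using BH by (intro arg_cong[where f = card]) auto
    also have "\<dots> = card (nbhd ?B v) + card (nbhd (H - ?B) v)"
      using fin finite_subset[OF BH fin] by (intro card_Un_disjoint) auto
    finally have "card (nbhd ?B v) = card (nbhd H v) - card (nbhd (H - ?B) v)" by simp
    also have "\<dots> \<le> card (L v) - card (\<phi> ` nbhd (H - ?B) v)"
      by (rule diff_le_mono[THEN order_trans, OF _ diff_le_mono2[OF card_image_le[OF f]]])
        (use deg v BH in blast)
    also have "\<dots> \<le> card (L' v)"
      unfolding L'_def using f by (intro diff_card_le_card_Diff) auto
    finally show ?thesis .
  qed
  have finL': "finite (L' v)" if "v \<in> ?B" for v
    using finL BH that by (auto simp: L'_def)
  obtain A where A: "\<And>v. v \<in> ?B \<Longrightarrow> L' v = A" "\<And>v. v \<in> ?B \<Longrightarrow> card (nbhd ?B v) = card A"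
      "3 \<le> card A \<Longrightarrow> clique ?B"
    by (rule uniform_or_colorable[OF finite_subset[OF BH fin] cB insert_not_empty two deg' finL' nc'])
      blast+
  show thesis
  proof (rule that[OF W])
    show "card (nbhd ?B v) = card A" if "v \<in> ?B" for v
      using A(2)[OF that] .
    show "card (nbhd H v) = card A" if "v \<in> W" for v
      using A(2)[of v] L'W(2)[OF that] that by simp
    show "card (L v) = card A" if "v \<in> W" for v
      using A(1)[of v] L'W(1)[OF that] that by simp
  qed (rule A(3))
qed

end

section \<open>Matchings and conflict colorings\<close>

text \<open>Induction in the style of Halmos and Vaughan. A proper nonempty \<open>J\<close> with
  equality is matched within its own union, which is then removed from the other sets. If there is
  no such \<open>J\<close>, Hall's condition has slack one and survives the removal of any single
  element.\<close>

lemma hall: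
  assumes "finite I" "\<And>i. i \<in> I \<Longrightarrow> finite (A i)"
    and "\<And>J. J \<subseteq> I \<Longrightarrow> card J \<le> card (\<Union>(A ` J))"
  shows "\<exists>f. inj_on f I \<and> (\<forall>i \<in> I. f i \<in> A i)"
  using assms
proof (induction "card I" arbitrary: I A rule: less_induct)
  case less
  show ?case
  proof (cases "I = {}")
    case False
    show ?thesis
    proof (cases "\<exists>J. J \<subset> I \<and> J \<noteq> {} \<and> card (\<Union>(A ` J)) = card J")
      case True
      then obtain J where J: "J \<subset> I" "J \<noteq> {}" "card (\<Union>(A ` J)) = card J" by blast
      let ?U = "\<Union>(A ` J)"
      have finJ: "finite J" using J(1) less.prems(1) finite_subset by blast
      have finU: "finite ?U" using finJ J(1) less.prems(2) by blast
      have "\<exists>f. inj_on f J \<and> (\<forall>i \<in> J. f i \<in> A i)"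
        using J(1) less.prems finJ by (intro less.hyps psubset_card_mono) auto
      then obtain f where f: "inj_on f J" "\<forall>i \<in> J. f i \<in> A i" by blast
      have "\<exists>g. inj_on g (I - J) \<and> (\<forall>i \<in> I - J. g i \<in> A i - ?U)"
      proof (rule less.hyps)
        show "card (I - J) < card I"
          using J(1,2) less.prems(1) by (intro psubset_card_mono) auto
        fix K assume K: "K \<subseteq> I - J"
        have finK: "finite K" using K less.prems(1) finite_subset by blast
        have finAK: "finite (\<Union>((\<lambda>i. A i - ?U) ` K))" using finK K less.prems(2) by auto
        have "card K + card J = card (K \<union> J)"
          using K finK finJ by (intro card_Un_disjoint[symmetric]) auto
        also have "\<dots> \<le> card (\<Union>(A ` (K \<union> J)))"
          using K J(1) by (intro less.prems(3)) auto
        also have "\<Union>(A ` (K \<union> J)) = \<Union>((\<lambda>i. A i - ?U) ` K) \<union> ?U" by auto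
        also have "card \<dots> = card (\<Union>((\<lambda>i. A i - ?U) ` K)) + card ?U"
          using finAK finU by (intro card_Un_disjoint) auto
        finally show "card K \<le> card (\<Union>((\<lambda>i. A i - ?U) ` K))" using J(3) by simp
      qed (use less.prems in auto)
      then obtain g where g: "inj_on g (I - J)" "\<forall>i \<in> I - J. g i \<in> A i - ?U" by blast
      let ?h = "\<lambda>i. if i \<in> J then f i else g i"
      have "inj_on ?h I"
      proof (rule inj_onI)
        fix i j assume ij: "i \<in> I" "j \<in> I" "?h i = ?h j"
        have cross: "f i \<noteq> g j" if "i \<in> J" "j \<in> I - J" for i j
        proof -
          have "f i \<in> ?U" using f(2) that(1) by (intro UN_I[of i]) auto
          moreover have "g j \<notin> ?U" using g(2) that(2) by (metis Diff_iff)
          ultimately show ?thesis by metis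
        qed
        show "i = j"
        proof (cases "i \<in> J"; cases "j \<in> J")
          assume "i \<in> J" "j \<in> J"
          then show ?thesis using ij inj_onD[OF f(1), of i j] by simp
        next
          assume "i \<in> J" "j \<notin> J"
          then show ?thesis using ij cross[of i j] by simp
        next
          assume "i \<notin> J" "j \<in> J"
          then show ?thesis using ij cross[of j i] by simp
        next
          assume "i \<notin> J" "j \<notin> J"
          then show ?thesis using ij inj_onD[OF g(1), of i j] by simp
        qed
      qed
      moreover have "\<forall>i \<in> I. ?h i \<in> A i" using f(2) g(2) by auto
      ultimately show ?thesis by blast
    next
      case no: False
      obtain i where i: "i \<in> I" using False by blast
      have "card {i} \<le> card (\<Union>(A ` {i}))" using i by (intro less.prems(3)) auto
      then obtain a where a: "a \<in> A i" by fastforce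
      have "\<exists>f. inj_on f (I - {i}) \<and> (\<forall>j \<in> I - {i}. f j \<in> A j - {a})"
      proof (rule less.hyps)
        show "card (I - {i}) < card I" using i less.prems(1) by (intro card_Diff1_less)
        fix J assume J: "J \<subseteq> I - {i}"
        have eq: "\<Union>((\<lambda>j. A j - {a}) ` J) = \<Union>(A ` J) - {a}" by auto
        show "card J \<le> card (\<Union>((\<lambda>j. A j - {a}) ` J))"
        proof (cases "J = {}")
          case False
          have "J \<subset> I" using J i by blast
          then have "card J \<le> card (\<Union>(A ` J))" "card (\<Union>(A ` J)) \<noteq> card J"
            using less.prems(3)[of J] no False by blast+
          then have "card J < card (\<Union>(A ` J))" by linarith
          then show ?thesis unfolding eq using diff_card_le_card_Diff[of "{a}" "\<Union>(A ` J)"] by simp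
        qed simp
      qed (use less.prems in auto)
      then obtain f where f: "inj_on f (I - {i})" "\<forall>j \<in> I - {i}. f j \<in> A j - {a}" by blast
      have "inj_on (f(i := a)) (insert i (I - {i}))"
        using f by (auto simp: inj_on_def)
      then have "inj_on (f(i := a)) I" using i by (simp add: insert_absorb)
      moreover have "\<forall>j \<in> I. (f(i := a)) j \<in> A j" using f(2) a by auto
      ultimately show ?thesis by blast
    qed
  qed auto
qed

text \<open>
  The edges \<open>{h i, k i}\<close> carry conflict relations that are partial matchings. Orienting each edge
  away from \<open>h i\<close> gives out-degree at most one, so every subgraph has a vertex of degree at most two.
\<close>

lemma conflict_coloring:
  fixes L :: "'p \<Rightarrow> 'c set"
  assumes "finite Q" "finite I" "inj_on h I"
    and "\<And>i. i \<in> I \<Longrightarrow> h i \<in> Q" "\<And>i. i \<in> I \<Longrightarrow> k i \<in> Q" "\<And>i. i \<in> I \<Longrightarrow> h i \<noteq> k i"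
    and "\<And>p. p \<in> Q \<Longrightarrow> 3 \<le> card (L p)"
    and R1: "\<And>i \<alpha> \<beta> \<beta>'. R i \<alpha> \<beta> \<Longrightarrow> R i \<alpha> \<beta>' \<Longrightarrow> \<beta> = \<beta>'"
    and R2: "\<And>i \<alpha> \<alpha>' \<beta>. R i \<alpha> \<beta> \<Longrightarrow> R i \<alpha>' \<beta> \<Longrightarrow> \<alpha> = \<alpha>'"
  shows "\<exists>c. (\<forall>p \<in> Q. c p \<in> L p) \<and> (\<forall>i \<in> I. \<not> R i (c (h i)) (c (k i)))"
  using assms(1-7)
proof (induction "card Q" arbitrary: Q I)
  case 0
  then have "Q = {}" by simp
  moreover have "I = {}" using 0 \<open>Q = {}\<close> by (metis all_not_in_conv)
  ultimately show ?case by simp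
next
  case (Suc n)
  \<comment> \<open>If every vertex were \<open>k i\<close> for at least two edges, there would be
    \<open>2 * card Q\<close> edges, whereas injectivity of \<open>h\<close> allows only
    \<open>card Q\<close>.\<close>
  have "\<exists>p \<in> Q. card {i \<in> I. k i = p} \<le> 1"
  proof (rule ccontr)
    assume "\<not> ?thesis"
    then have ge: "2 \<le> card {i \<in> I. k i = p}" if "p \<in> Q" for p using that by fastforce
    have "card Q * 2 \<le> (\<Sum>p \<in> Q. card {i \<in> I. k i = p})"
      using sum_bounded_below[of Q 2 "\<lambda>p. card {i \<in> I. k i = p}"] ge by simp
    also have "\<dots> = card (\<Union>p \<in> Q. {i \<in> I. k i = p})"
      using Suc.prems(1,2) by (intro card_UN_disjoint[symmetric]) auto
    also have "\<dots> \<le> card I" using Suc.prems(2) by (intro card_mono) auto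
    also have "\<dots> = card (h ` I)" using Suc.prems(3) by (simp add: card_image)
    also have "\<dots> \<le> card Q" using Suc.prems(1,4) by (intro card_mono) auto
    finally show False using Suc.hyps(2) by simp
  qed
  then obtain p where p: "p \<in> Q" "card {i \<in> I. k i = p} \<le> 1" by blast
  have h1: "card {i \<in> I. h i = p} \<le> 1"
    using Suc.prems(2,3) by (auto simp: card_le_Suc0_iff_eq inj_on_def)
  let ?I = "{i \<in> I. h i \<noteq> p \<and> k i \<noteq> p}"
  let ?T = "{i \<in> I. h i = p} \<union> {i \<in> I. k i = p}"
  have "\<exists>c. (\<forall>q \<in> Q - {p}. c q \<in> L q) \<and> (\<forall>i \<in> ?I. \<not> R i (c (h i)) (c (k i)))"
  proof (rule Suc.hyps(1))
    show "n = card (Q - {p})" using Suc.hyps(2) p(1) Suc.prems(1) by simp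
    show "inj_on h ?I" using Suc.prems(3) by (rule inj_on_subset) auto
  qed (use Suc.prems in auto)
  then obtain c where c: "\<forall>q \<in> Q - {p}. c q \<in> L q" "\<forall>i \<in> ?I. \<not> R i (c (h i)) (c (k i))" by blast
  \<comment> \<open>The colours at \<open>p\<close> that edge \<open>i\<close> forbids, given the
    colour at its other end. By \<open>R1\<close> and \<open>R2\<close> each edge forbids at most
    one, so the edges at \<open>p\<close> forbid at most two.\<close>
  define F where "F = (\<lambda>i. {\<gamma>. if h i = p then R i \<gamma> (c (k i)) else R i (c (h i)) \<gamma>})"
  have F1: "finite (F i) \<and> card (F i) \<le> 1" for i
  proof -
    have "\<exists>y. F i \<subseteq> {y}"
    proof (cases "F i = {}")
      case False
      then obtain y where "y \<in> F i" by blast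
      then have "F i \<subseteq> {y}"
        unfolding F_def using R1[of i "c (h i)"] R2[of i _ "c (k i)"] by (auto split: if_splits)
      then show ?thesis by blast
    qed simp
    then show ?thesis
      using card_mono[of "{y}" "F i" for y] finite_subset by (metis card.empty card.insert
          empty_iff finite.emptyI finite.insertI One_nat_def)
  qed
  have finT: "finite ?T" using Suc.prems(2) by simp
  have "card (\<Union>i \<in> ?T. F i) \<le> (\<Sum>i \<in> ?T. card (F i))"
    using finT by (rule card_UN_le)
  also have "\<dots> \<le> of_nat (card ?T) * 1"
    using F1 by (intro sum_bounded_above) auto
  also have "\<dots> \<le> 2"
    using card_Un_le[of "{i \<in> I. h i = p}" "{i \<in> I. k i = p}"] h1 p(2) by simp
  finally have "card (\<Union>i \<in> ?T. F i) < card (L p)" using Suc.prems(7)[OF p(1)] by linarith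
  moreover have "finite (\<Union>i \<in> ?T. F i)" using finT F1 by blast
  ultimately have "\<not> L p \<subseteq> (\<Union>i \<in> ?T. F i)"
    using card_mono by (metis not_less)
  then obtain \<gamma> where \<gamma>: "\<gamma> \<in> L p" "\<gamma> \<notin> (\<Union>i \<in> ?T. F i)" by blast
  have "\<not> R i ((c(p := \<gamma>)) (h i)) ((c(p := \<gamma>)) (k i))" if i: "i \<in> I" for i
  proof (cases "i \<in> ?T")
    case True
    then have "\<gamma> \<notin> F i" using \<gamma>(2) by blast
    then show ?thesis using True Suc.prems(6)[OF i] by (auto simp: F_def split: if_splits)
  next
    case False
    then show ?thesis using c(2) i by simp
  qed
  moreover have "\<forall>q \<in> Q. (c(p := \<gamma>)) q \<in> L q" using c(1) \<gamma>(1) by simp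
  ultimately show ?case by blast
qed

lemma card_diff_image_ge: "finite N \<Longrightarrow> card A - card N \<le> card (A - f ` N)"
  using diff_card_le_card_Diff[of "f ` N" A] card_image_le[of N f] by simp

section \<open>Gadgets: cliques attached to a vertex with a short list\<close>

text \<open>An upper bound \<open>D\<close> on the degrees and the absence of cliques of order
  \<open>D + 1\<close> stand in for connectedness and non-completeness, because they pass to induced
  subgraphs. The last two conditions put distinct vertices of \<open>P\<close> at distance at least
  three.\<close>

locale brooks_graph = simple_graph E for E :: "'a \<Rightarrow> 'a \<Rightarrow> bool" +
  fixes D :: nat and V P :: "'a set"
  assumes finV: "finite V" and D4: "4 \<le> D"
    and deg: "v \<in> V \<Longrightarrow> card (nbhd V v) \<le> D"
    and no_clique: "S \<subseteq> V \<Longrightarrow> clique S \<Longrightarrow> card S \<noteq> D + 1"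
    and PV: "P \<subseteq> V"
    and P_indep: "p \<in> P \<Longrightarrow> q \<in> P \<Longrightarrow> \<not> E p q"
    and P_dist: "v \<in> V \<Longrightarrow> p \<in> P \<Longrightarrow> q \<in> P \<Longrightarrow> E v p \<Longrightarrow> E v q \<Longrightarrow> p = q"
begin

lemma brooks_graph_subset: "U \<subseteq> V \<Longrightarrow> brooks_graph E D U (P \<inter> U)"
proof
  fix v assume "U \<subseteq> V" "v \<in> U"
  then show "card (nbhd U v) \<le> D"
    using card_nbhd_mono[OF finV, of U v] deg[of v] by auto
qed (use finV D4 no_clique P_indep P_dist finite_subset in auto)

definition gadget :: "'a \<Rightarrow> 'a set \<Rightarrow> 'a \<Rightarrow> bool" where
  "gadget p W x \<longleftrightarrow> p \<in> P \<and> W \<subseteq> V - P \<and> x \<in> V - P - W \<and> card W = D - 1 \<and>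
    clique (insert x W) \<and> (\<forall>w \<in> W. E p w) \<and> \<not> E p x"

lemma gadgetD:
  assumes "gadget p W x"
  shows "p \<in> P" "W \<subseteq> V - P" "x \<in> V - P" "x \<notin> W" "card W = D - 1" "clique (insert x W)"
    "\<And>w. w \<in> W \<Longrightarrow> E p w" "\<not> E p x" "p \<in> V" "finite W" "W \<noteq> {}" "p \<notin> W" "p \<noteq> x"
proof -
  show *: "p \<in> P" "W \<subseteq> V - P" "x \<in> V - P" "x \<notin> W" "card W = D - 1" "clique (insert x W)"
    "\<And>w. w \<in> W \<Longrightarrow> E p w" "\<not> E p x"
    using assms by (auto simp: gadget_def)
  show "p \<in> V" using * PV by auto
  show "finite W" using *(2) finV finite_subset by blast
  show "W \<noteq> {}" using *(5) D4 by auto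
  show "p \<notin> W" "p \<noteq> x" using * by auto
qed

lemma gadget_adj: "gadget p W x \<Longrightarrow> w \<in> W \<Longrightarrow> E x w"
  using gadgetD(4,6)[of p W x] by (auto simp: clique_def)

text \<open>The listed vertices are already \<open>D\<close> neighbours of \<open>w\<close>, so the
  degree bound leaves room for no other.\<close>

lemma gadget_nbhd:
  assumes g: "gadget p W x" and w: "w \<in> W"
  shows "nbhd V w = insert p (insert x (W - {w}))"
proof (rule card_seteq[symmetric])
  show "finite (nbhd V w)" using finV by simp
  have "E w v" if "v \<in> insert x W" "v \<noteq> w" for v
    using gadgetD(6)[OF g] w that by (auto simp: clique_def)
  moreover have "E w p" using gadgetD(7)[OF g w] sym by blast
  ultimately show "insert p (insert x (W - {w})) \<subseteq> nbhd V w"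
    using gadgetD(2,3,4,9)[OF g] w by (intro subsetI) auto
  have "card (insert p (insert x (W - {w}))) = D"
    using gadgetD[OF g] w D4 by simp
  then show "card (nbhd V w) \<le> card (insert p (insert x (W - {w})))"
    using deg[of w] w gadgetD(2)[OF g] by auto
qed

text \<open>Both \<open>p\<close> and \<open>x\<close> spend \<open>D - 1\<close> of their at most
  \<open>D\<close> edges on \<open>W\<close>.\<close>

lemma gadget_outer:
  assumes g: "gadget p W x" and z: "z = p \<or> z = x"
  shows "card (nbhd V z - W) \<le> 1"
proof -
  have "W \<subseteq> nbhd V z"
    using gadgetD[OF g] gadget_adj[OF g] z by auto
  then have "card (nbhd V z - W) = card (nbhd V z) - (D - 1)"
    using gadgetD(5,10)[OF g] by (simp add: card_Diff_subset)
  then show ?thesis using deg[of z] gadgetD(3,9)[OF g] z D4 by auto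
qed

text \<open>
  A colour of \<open>p\<close> can only be a bad choice if it determines the list of colours available at \<open>x\<close>.
\<close>

lemma gadget_extend:
  assumes g: "gadget p W x" and U: "U \<subseteq> V" "U \<inter> insert x W = {}" "p \<in> U"
    and \<phi>: "colors U L \<phi>" and L: "\<And>v. v \<in> insert x W \<Longrightarrow> card (L v) = D"
    and w0: "w0 \<in> W" "\<phi> p \<notin> L w0 \<or> L x - \<phi> ` nbhd U x \<noteq> L w0 - {\<phi> p}"
  obtains \<psi> where "colors (U \<union> insert x W) L \<psi>" "\<And>v. v \<in> U \<Longrightarrow> \<psi> v = \<phi> v"
proof -
  note gd = gadgetD[OF g]
  define a where "a = \<phi> p"
  define Lx where "Lx = L x - \<phi> ` nbhd U x"
  have finU: "finite U" using U(1) finV finite_subset by blast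
  have finL: "finite (L v)" if "v \<in> insert x W" for v
    using L[OF that] D4 card.infinite by fastforce
  have "nbhd U x \<subseteq> nbhd V x - W" using U by auto
  then have "card (nbhd U x) \<le> 1"
    using gadget_outer[OF g, of x] card_mono[of "nbhd V x - W" "nbhd U x"] finV by auto
  then have cLx: "D - 1 \<le> card Lx"
    using card_diff_image_ge[of "nbhd U x" "L x" \<phi>] finU L[of x] by (simp add: Lx_def)
  \<comment> \<open>The colour \<open>b\<close> intended for \<open>x\<close> is chosen so that
    \<open>w0\<close> loses at most one colour to \<open>a\<close> and \<open>b\<close> together. As
    \<open>w0\<close> has degree \<open>D - 2\<close> in the clique \<open>W\<close>, it keeps a
    spare colour there.\<close>
  have "\<exists>b \<in> Lx. D - 1 \<le> card (L w0 - {a, b})"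
  proof (cases "a \<in> L w0")
    case False
    have "Lx \<noteq> {}" using cLx D4 by auto
    then obtain b where "b \<in> Lx" by blast
    moreover have "L w0 - {a, b} = L w0 - {b}" using False by auto
    ultimately show ?thesis
      using L[of w0] w0(1) by (intro bexI[of _ b]) (auto simp: card_Diff_singleton_if)
  next
    case True
    then have c: "card (L w0 - {a}) = D - 1" using L[of w0] w0(1) finL[of w0] by simp
    have "\<not> Lx \<subseteq> L w0 - {a}"
    proof
      assume "Lx \<subseteq> L w0 - {a}"
      then have "Lx = L w0 - {a}"
        using cLx c finL[of w0] w0(1) by (intro card_seteq) auto
      then show False using w0(2) True by (simp add: a_def Lx_def)
    qed
    then obtain b where b: "b \<in> Lx" "b \<notin> L w0 - {a}" by blast
    then have "L w0 - {a, b} = L w0 - {a}" by auto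
    then show ?thesis using b(1) c by (intro bexI[of _ b]) auto
  qed
  then obtain b where b: "b \<in> Lx" "D - 1 \<le> card (L w0 - {a, b})" by blast
  have cW: "clique W" using gd(6) clique_subset by blast
  have dW: "card (nbhd W w) = D - 2" if "w \<in> W" for w
    using that nbhd_clique[OF cW that] gd(5,10) by simp
  have "colorable W (\<lambda>w. L w - {a, b})"
  proof (rule greedy_conn[OF gd(10) conn_clique[OF cW] w0(1)])
    show "card (nbhd W w0) < card (L w0 - {a, b})"
      using b(2) dW[OF w0(1)] D4 by simp
    fix w assume w: "w \<in> W"
    have "card (L w) - card {a, b} \<le> card (L w - {a, b})"
      by (intro diff_card_le_card_Diff) auto
    moreover have "card {a, b} \<le> 2" by (simp add: card_insert_if)
    ultimately show "card (nbhd W w) \<le> card (L w - {a, b})"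
      using dW[OF w] L[of w] w by simp
  qed
  then obtain \<chi> where \<chi>: "colors W (\<lambda>w. L w - {a, b}) \<chi>" by (auto simp: colorable_def)
  have nbU: "nbhd U w = {p}" if "w \<in> W" for w
  proof -
    have "nbhd U w = nbhd V w \<inter> U" using U(1) by auto
    then show ?thesis using gadget_nbhd[OF g that] U(2,3) by auto
  qed
  have "colorable (insert x W) (\<lambda>v. L v - \<phi> ` nbhd U v)"
  proof (rule colorable_insert[of _ _ b])
    have "colors W (\<lambda>u. if E x u then L u - \<phi> ` nbhd U u - {b} else L u - \<phi> ` nbhd U u) \<chi>"
      using \<chi> nbU gadget_adj[OF g] by (auto simp: colors_def a_def)
    then show "colorable W (\<lambda>u. if E x u then L u - \<phi> ` nbhd U u - {b} else L u - \<phi> ` nbhd U u)"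
      by (auto simp: colorable_def)
  qed (use b(1) gd(4) in \<open>auto simp: Lx_def\<close>)
  then show thesis
    by (rule extend_colors[OF \<phi> U(2)]) (rule that)
qed

section \<open>Lists that remain after colouring vertices of \<open>P\<close>\<close>

text \<open>Each neighbour in \<open>Q\<close> removes at most one colour and takes up one of the at
  most \<open>D\<close> edges at \<open>v\<close>.\<close>

lemma card_residual_ge:
  assumes "H \<subseteq> V - Q" "Q \<subseteq> V" "v \<in> H" "card (L v) = D"
  shows "card (nbhd H v) \<le> card (L v - c ` nbhd Q v)"
proof -
  have finQ: "finite Q" using assms(2) finV finite_subset by blast
  have finH: "finite H" using assms(1) finV finite_subset by (metis finite_Diff)
  have "card (nbhd H v) + card (nbhd Q v) = card (nbhd H v \<union> nbhd Q v)"
    using assms(1) finQ finH by (intro card_Un_disjoint[symmetric]) auto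
  also have "\<dots> \<le> card (nbhd V v)"
    using assms(1,2) finV by (intro card_mono) auto
  also have "\<dots> \<le> D" using deg assms(1,3) by blast
  finally show ?thesis
    using card_diff_image_ge[of "nbhd Q v" "L v" c] finQ assms(4) by simp
qed

lemma card_nbhd_P:
  assumes "Q \<subseteq> P" "v \<in> V"
  shows "card (nbhd Q v) \<le> 1"
proof -
  have "a = b" if "a \<in> nbhd Q v" "b \<in> nbhd Q v" for a b
    using P_dist[OF assms(2), of a b] that assms(1) by auto
  moreover have "finite (nbhd Q v)"
    using assms(1) PV finV finite_subset by (metis finite_nbhd)
  ultimately show ?thesis by (simp add: card_le_Suc0_iff_eq)
qed

lemma clique_card_ne:
  assumes "clique B" "B \<subseteq> V" "v \<in> B" "card (nbhd B v) = s"
  shows "card B = s + 1" "s \<noteq> D"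
proof -
  have "finite B" using assms(2) finV finite_subset by blast
  then show "card B = s + 1"
    using nbhd_clique[OF assms(1,3)] assms(3,4) by (metis Suc_eq_plus1 card_Suc_Diff1)
  then show "s \<noteq> D" using no_clique[OF assms(2,1)] by auto
qed

text \<open>If \<open>p\<close> were adjacent to \<open>x\<close> too, then
  \<open>insert p (insert x W)\<close> would be a forbidden clique of order
  \<open>D + 1\<close>.\<close>

lemma clique_gadget:
  assumes "clique (insert x W)" "insert x W \<subseteq> V - P" "x \<notin> W" "card W = D - 1" "p \<in> P"
    and "\<And>w. w \<in> W \<Longrightarrow> E p w"
  shows "gadget p W x"
proof -
  have finW: "finite W" using assms(2) finV finite_subset by (metis finite_Diff finite_insert)
  have "\<not> E p x"
  proof
    assume px: "E p x"
    have "clique (insert p (insert x W))"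
      using assms(1,6) px sym by (auto simp: clique_def)
    moreover have "insert p (insert x W) \<subseteq> V" using assms(2,5) PV by auto
    moreover have "card (insert p (insert x W)) = D + 1"
      using assms(2,3,4,5) finW D4 by (subst card_insert_disjoint) auto
    ultimately show False using no_clique by blast
  qed
  then show ?thesis using assms by (auto simp: gadget_def)
qed

section \<open>Lists of size three\<close>


text \<open>For a vertex of \<open>V\<close> with a neighbour in \<open>P\<close>, this neighbour is
  unique by \<open>P_dist\<close>; without such a neighbour the value is arbitrary.\<close>

definition pnbr :: "'a \<Rightarrow> 'a" where
  "pnbr v = (SOME p. p \<in> P \<and> E v p)"

lemma pnbr_eq:
  assumes "v \<in> V" "p \<in> P" "E v p"
  shows "pnbr v = p"
proof -
  have "pnbr v \<in> P \<and> E v (pnbr v)"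
    unfolding pnbr_def by (rule someI[of _ p]) (use assms in auto)
  then show ?thesis using P_dist[OF assms(1) _ assms(2) _ assms(3)] by blast
qed

lemma nbhd_P_eq:
  assumes "v \<in> V" "p \<in> P" "E v p"
  shows "nbhd P v = {p}"
proof -
  have "q = p" if "q \<in> nbhd P v" for q
    using P_dist[OF assms(1) _ assms(2) _ assms(3), of q] that by simp
  moreover have "p \<in> nbhd P v" using assms(2,3) by simp
  ultimately show ?thesis by blast
qed

lemma finP: "finite P"
  using PV finV finite_subset by blast

text \<open>The residual lists have size \<open>D - 1\<close> or \<open>D\<close>, so a tight end
  block is a clique of order \<open>D\<close> or \<open>D + 1\<close>, and the latter is excluded.
  Hence every vertex of \<open>W\<close> has lost a colour to a neighbour in \<open>P\<close>; were
  these neighbours all equal, the block would be a gadget.\<close>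

lemma leaf_in_component:
  assumes H: "H \<subseteq> V - P" "conn H" and LD: "\<And>v. v \<in> V - P \<Longrightarrow> card (L v) = D"
    and nc: "\<not> colorable H (\<lambda>v. L v - c ` nbhd P v)"
    and W0: "W0 \<subseteq> H" "W0 \<noteq> {}" "W0 \<noteq> H" "attached H W0 x0"
    and no_gadget: "\<And>p W x. \<not> gadget p W x"
  obtains x W where "W \<subseteq> W0" "leaf H x W" "clique (insert x W)" "card W = D - 1"
    "\<And>v. v \<in> W \<Longrightarrow> pnbr v \<in> P \<and> E v (pnbr v)"
    "\<And>q. \<exists>v \<in> W. pnbr v \<noteq> q"
proof -
  let ?L = "\<lambda>v. L v - c ` nbhd P v"
  have HV: "H \<subseteq> V" "finite H" using H(1) finV finite_subset by (blast, metis finite_Diff)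
  have cL: "D - 1 \<le> card (?L v)" "card (?L v) \<le> D" "finite (L v)" if "v \<in> H" for v
  proof -
    have v: "v \<in> V" "v \<in> V - P" using that H(1) by auto
    show "D - 1 \<le> card (?L v)"
      using card_diff_image_ge[of "nbhd P v" "L v" c] finP card_nbhd_P[of P v] v LD[OF v(2)] by simp
    show fin: "finite (L v)" using LD[OF v(2)] D4 card.infinite by fastforce
    show "card (?L v) \<le> D" using LD[OF v(2)] card_mono[OF fin, of "?L v"] by auto
  qed
  have dg: "card (nbhd H v) \<le> card (?L v)" if "v \<in> H" for v
    using card_residual_ge[OF H(1) PV that] LD that H(1) by blast
  have finL: "finite (?L v)" if "v \<in> H" for v using cL(3)[OF that] by simp
  obtain x W s where W: "W \<subseteq> W0" "leaf H x W"
    "\<And>v. v \<in> insert x W \<Longrightarrow> card (nbhd (insert x W) v) = s"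
    "\<And>v. v \<in> W \<Longrightarrow> card (nbhd H v) = s" "\<And>v. v \<in> W \<Longrightarrow> card (?L v) = s"
    "3 \<le> s \<Longrightarrow> clique (insert x W)"
    by (rule tight_leaf[OF HV(2) H(2) dg finL nc W0]) blast+
  have WH: "insert x W \<subseteq> H" "x \<notin> W" "W \<noteq> {}" using leaf_subset[OF W(2)] leafD[OF W(2)] by auto
  then obtain w where w: "w \<in> W" by blast
  have s: "D - 1 \<le> s" "s \<le> D" using cL[of w] W(5)[OF w] w WH(1) by auto
  have cl: "clique (insert x W)" using W(6) s D4 by linarith
  have BV: "insert x W \<subseteq> V" using WH(1) HV(1) by blast
  have "card (insert x W) = s + 1" "s \<noteq> D"
    using clique_card_ne[OF cl BV _ W(3)] by blast+
  then have sD: "s = D - 1" "card (insert x W) = D" using s D4 by auto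
  have finW: "finite W" using finite_subset[OF WH(1) HV(2)] by simp
  have cW: "card W = D - 1" using sD(2) WH(2) finW by simp
  have pn: "pnbr v \<in> P \<and> E v (pnbr v)" if v: "v \<in> W" for v
  proof -
    have vV: "v \<in> V - P" using v WH(1) H(1) by auto
    have "nbhd P v \<noteq> {}"
    proof
      assume "nbhd P v = {}"
      then show False using W(5)[OF v] sD(1) LD[OF vV] D4 by simp
    qed
    then obtain p where "p \<in> nbhd P v" by blast
    then show ?thesis using pnbr_eq[of v p] vV by simp
  qed
  have ne: "\<exists>v \<in> W. pnbr v \<noteq> q" for q
  proof (rule ccontr)
    assume "\<not> ?thesis"
    then have all: "E v q" "q \<in> P" if "v \<in> W" for v
      using pn[OF that] that by auto
    have "gadget q W x"
    proof (rule clique_gadget[OF cl _ WH(2) cW])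
      show "insert x W \<subseteq> V - P" using WH(1) H(1) by blast
      show "q \<in> P" using all(2) w by blast
      show "E q v" if "v \<in> W" for v using all(1)[OF that] sym by blast
    qed
    then show False using no_gadget by blast
  qed
  show thesis by (rule that[OF W(1,2) cl cW pn ne])
qed

text \<open>If \<open>H\<close> is a single end block, \<open>S\<close> is all of \<open>H\<close>,
  a clique of order \<open>D\<close>. Otherwise \<open>S\<close> collects the vertices of two end
  blocks apart from their cut vertices, which gives \<open>2 * (D - 1)\<close> of them. The bound
  \<open>D \<le> card S\<close> is what Hall's condition later requires.\<close>

lemma bad_component:
  assumes H: "H \<subseteq> V - P" "conn H" "H \<noteq> {}" and LD: "\<And>v. v \<in> V - P \<Longrightarrow> card (L v) = D"
    and nc: "\<not> colorable H (\<lambda>v. L v - c ` nbhd P v)"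
    and no_gadget: "\<And>p W x. \<not> gadget p W x"
  obtains S where "S \<subseteq> H" "D \<le> card S" "\<And>v. v \<in> S \<Longrightarrow> pnbr v \<in> P \<and> E v (pnbr v)"
    "\<And>v. v \<in> S \<Longrightarrow> \<exists>v' \<in> S. E v v' \<and> pnbr v \<noteq> pnbr v' \<and> conn (H - {v})"
proof -
  let ?L = "\<lambda>v. L v - c ` nbhd P v"
  have HV: "H \<subseteq> V" "finite H" using H(1) finV finite_subset by (blast, metis finite_Diff)
  obtain r where r: "r \<in> H" using H(3) by blast
  have "H \<noteq> {r}"
  proof
    assume Hr: "H = {r}"
    have rV: "r \<in> V" "r \<in> V - P" using r H(1) by auto
    have "card (L r) - card (nbhd P r) \<le> card (?L r)"
      using card_diff_image_ge[of "nbhd P r" "L r" c] finP by simp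
    then have "card (?L r) \<noteq> 0"
      using card_nbhd_P[of P r] rV LD[OF rV(2)] D4 by simp
    then obtain a where "a \<in> ?L r" by (metis card.empty ex_in_conv)
    then have "colors H ?L (\<lambda>_. a)" using Hr irrefl by (auto simp: colors_def)
    then show False using nc by (auto simp: colorable_def)
  qed
  then have W0: "H - {r} \<noteq> {}" "H - {r} \<noteq> H" "attached H (H - {r}) r"
    using r by (auto simp: attached_def)
  obtain x W where W: "W \<subseteq> H - {r}" "leaf H x W" "clique (insert x W)" "card W = D - 1"
    "\<And>v. v \<in> W \<Longrightarrow> pnbr v \<in> P \<and> E v (pnbr v)" "\<And>q. \<exists>v \<in> W. pnbr v \<noteq> q"
    by (rule leaf_in_component[OF H(1,2) LD nc Diff_subset W0 no_gadget]) blast+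
  have leafE: "\<exists>v' \<in> W. E v v' \<and> pnbr v \<noteq> pnbr v' \<and> conn (H - {v})"
    if leaf': "leaf H x W" "clique (insert x W)" "\<And>q. \<exists>v \<in> W. pnbr v \<noteq> q" "v \<in> W" for x W v
  proof -
    obtain v' where v': "v' \<in> W" "pnbr v' \<noteq> pnbr v" using leaf'(3) by blast
    then have "E v v'" using leaf'(2,4) by (auto simp: clique_def)
    then show ?thesis using v' leaf_remove_conn[OF leaf'(1) H(2) leaf'(4)] by auto
  qed
  have WH: "W \<subseteq> H" "x \<in> H" "x \<notin> W" "W \<noteq> {}" using leafD[OF W(2)] by auto
  have finW: "finite W" using finite_subset[OF WH(1) HV(2)] .
  show thesis
  proof (cases "H = insert x W")
    case True
    have xV: "x \<in> V - P" "x \<in> V" using H(1) WH(2) by auto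
    have dg: "card (nbhd H v) \<le> card (?L v)" if "v \<in> H" for v
      using card_residual_ge[OF H(1) PV that] LD that H(1) by blast
    \<comment> \<open>When \<open>H\<close> is one clique, \<open>x\<close> has no spare colour
      either, so it must also have lost a colour to a neighbour in \<open>P\<close>.\<close>
    have "\<not> card (nbhd H x) < card (?L x)"
      using greedy_conn[OF HV(2) H(2) WH(2) _ dg] nc by blast
    moreover have "card (nbhd H x) = D - 1"
      using nbhd_clique[OF W(3), of x] True WH(3) W(4) by simp
    ultimately have "nbhd P x \<noteq> {}" using LD[OF xV(1)] D4 by auto
    then obtain p where "p \<in> nbhd P x" by blast
    then have px: "pnbr x \<in> P \<and> E x (pnbr x)" using pnbr_eq[of x p] xV by simp
    obtain v' where v': "v' \<in> W" "pnbr v' \<noteq> pnbr x" using W(6) by blast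
    have x': "\<exists>v' \<in> H. E x v' \<and> pnbr x \<noteq> pnbr v' \<and> conn (H - {x})"
    proof -
      have "E x v'" using v' W(3) WH(3) by (auto simp: clique_def)
      moreover have "conn (H - {x})"
        using conn_clique[OF clique_subset[OF W(3), of "H - {x}"]] True by blast
      ultimately show ?thesis using v' WH(1) by auto
    qed
    show thesis
    proof (rule that[of H])
      show "D \<le> card H" using True W(4) WH(3) finW D4 by simp
      show "pnbr v \<in> P \<and> E v (pnbr v)" if "v \<in> H" for v
        using that True W(5) px by blast
      show "\<exists>v' \<in> H. E v v' \<and> pnbr v \<noteq> pnbr v' \<and> conn (H - {v})" if "v \<in> H" for v
      proof (cases "v = x")
        case False
        then have "v \<in> W" using that True by blast
        then show ?thesis using leafE[OF W(2,3,6)] WH(1) by blast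
      qed (use x' in simp)
    qed simp
  next
    case False
    \<comment> \<open>The rest of \<open>H\<close> is again attached to \<open>x\<close> and
      therefore contains a second end block, with \<open>W'\<close> disjoint from
      \<open>W\<close>.\<close>
    let ?W0 = "H - insert x W"
    have W0': "attached H ?W0 x"
      unfolding attached_def
    proof (intro ballI impI)
      fix u v assume uv: "u \<in> ?W0" "v \<in> H" "E u v"
      then have "v \<notin> W" using leaf_nbr[OF W(2), of v u] sym[OF uv(3)] by auto
      then show "v \<in> insert x ?W0" using uv by auto
    qed
    have W0: "?W0 \<noteq> {}" "?W0 \<noteq> H" using False WH by auto
    obtain x' W' where W': "W' \<subseteq> ?W0" "leaf H x' W'" "clique (insert x' W')"
      "card W' = D - 1" "\<And>v. v \<in> W' \<Longrightarrow> pnbr v \<in> P \<and> E v (pnbr v)" "\<And>q. \<exists>v \<in> W'. pnbr v \<noteq> q"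
      by (rule leaf_in_component[OF H(1,2) LD nc Diff_subset W0 W0' no_gadget]) blast+
    have W'H: "W' \<subseteq> H" "finite W'" using W'(1) finite_subset[OF _ HV(2), of W'] by auto
    show thesis
    proof (rule that[of "W \<union> W'"])
      show "W \<union> W' \<subseteq> H" using WH W'H by blast
      have "W \<inter> W' = {}" using W'(1) by blast
      then show "D \<le> card (W \<union> W')"
        using finW W'H(2) W(4) W'(4) D4 by (simp add: card_Un_disjoint)
      show "pnbr v \<in> P \<and> E v (pnbr v)" if "v \<in> W \<union> W'" for v
        using that W(5) W'(5) by blast
      show "\<exists>v' \<in> W \<union> W'. E v v' \<and> pnbr v \<noteq> pnbr v' \<and> conn (H - {v})" if "v \<in> W \<union> W'" for v
        using that leafE[OF W(2,3,6)] leafE[OF W'(2,3,6)] by blast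
    qed
  qed
qed

text \<open>
  Hence, in a component that cannot be coloured, the colours of \<open>p\<close> and \<open>p'\<close> determine each other.
\<close>

lemma bad_component_lists:
  assumes H: "H \<subseteq> V - P" "conn H" and LD: "\<And>v. v \<in> V - P \<Longrightarrow> card (L v) = D"
    and nc: "\<not> colorable H (\<lambda>v. L v - c ` nbhd P v)"
    and v: "v \<in> H" "v' \<in> H" "E v v'" "conn (H - {v})"
    and p: "p \<in> P" "E v p" "p' \<in> P" "E v' p'"
  shows "c p \<in> L v \<and> c p' \<in> L v' \<and> L v - {c p} = L v' - {c p'}"
proof -
  let ?L = "\<lambda>v. L v - c ` nbhd P v"
  have HV: "H \<subseteq> V" "finite H" using H(1) finV finite_subset by (blast, metis finite_Diff)
  have dg: "card (nbhd H v) \<le> card (?L v)" if "v \<in> H" for v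
    using card_residual_ge[OF H(1) PV that] LD that H(1) by blast
  have finL: "finite (L v)" if "v \<in> H" for v
  proof -
    have "card (L v) = D" using LD that H(1) by blast
    then show ?thesis using D4 card.infinite by fastforce
  qed
  have nb: "?L v = L v - {c p}" "?L v' = L v' - {c p'}"
    using nbhd_P_eq[of v p] nbhd_P_eq[of v' p'] v p HV(1) by auto
  have "?L v \<subseteq> ?L v'"
  proof
    fix a assume a: "a \<in> ?L v"
    show "a \<in> ?L v'"
    proof (rule ccontr)
      assume a': "a \<notin> ?L v'"
      show False
        using greedy_two_lists[OF HV(2) v(4,1,2,3) a a' dg] finL nc by simp
    qed
  qed
  \<comment> \<open>The edge to \<open>q\<close> leaves \<open>H\<close>, so \<open>u\<close> has
    fewer than \<open>D\<close> neighbours in \<open>H\<close>. Having no spare colour, it must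
    really lose the colour of \<open>q\<close> from its list.\<close>
  moreover have tight: "card (?L u) \<le> D - 1 \<and> c q \<in> L u" if "u \<in> H" "q \<in> P" "E u q" for u q
  proof -
    have uV: "u \<in> V" "u \<in> V - P" using that H(1) by auto
    have "\<not> card (nbhd H u) < card (?L u)"
      using greedy_conn[OF HV(2) H(2) that(1) _ dg] nc by blast
    moreover have "card (nbhd H u) < card (nbhd V u)"
    proof (rule psubset_card_mono)
      have "q \<in> nbhd V u" "q \<notin> nbhd H u" using that(2,3) PV H(1) by auto
      then show "nbhd H u \<subset> nbhd V u" using nbhd_mono[OF HV(1), of u] by blast
    qed (use finV in simp)
    moreover have "card (nbhd V u) \<le> D" using deg[OF uV(1)] .
    ultimately have c: "card (?L u) \<le> D - 1" by simp
    have "?L u = L u - {c q}" using nbhd_P_eq[OF uV(1) that(2,3)] by simp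
    then have "c q \<in> L u" using c LD[OF uV(2)] D4 by (cases "c q \<in> L u") auto
    then show ?thesis using c by simp
  qed
  ultimately have sub: "L v - {c p} \<subseteq> L v' - {c p'}" "c p \<in> L v" "c p' \<in> L v'"
    using tight[OF v(1) p(1,2)] tight[OF v(2) p(3,4)] nb by auto
  moreover have "card (L v - {c p}) = D - 1" "card (L v' - {c p'}) = D - 1"
    using sub(2,3) LD[of v] LD[of v'] v(1,2) H(1) finL by auto
  ultimately show ?thesis
    using card_subset_eq[OF _ sub(1)] finL[OF v(2)] by auto
qed

text \<open>Hall's theorem assigns to each bad component \<open>H\<close> its own vertex
  \<open>h H\<close> of \<open>P\<close>. An adjacent pair \<open>a H\<close>, \<open>b H\<close>
  then turns \<open>H\<close> into a conflict edge between \<open>h H\<close> and a second vertex of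
  \<open>P\<close>, so that \<open>conflict_coloring\<close> applies.\<close>

lemma colorable_without_gadgets:
  fixes L :: "'a \<Rightarrow> 'c set"
  assumes LD: "\<And>v. v \<in> V - P \<Longrightarrow> card (L v) = D" and LP: "\<And>p. p \<in> P \<Longrightarrow> 3 \<le> card (L p)"
    and no_gadget: "\<And>p W x. \<not> gadget p W x"
  shows "colorable V L"
proof -
  let ?L = "\<lambda>c v. L v - c ` nbhd P v"
  \<comment> \<open>Components that fail for at least one \<open>c\<close> are collected, since the
    conflict edges must be fixed before the colours of \<open>P\<close> are chosen.\<close>
  define BAD where "BAD = {H. closed_in (V - P) H \<and> H \<noteq> {} \<and> conn H \<and> (\<exists>c. \<not> colorable H (?L c))}"
  have BAD: "H \<subseteq> V - P" "conn H" "H \<noteq> {}" "closed_in (V - P) H" "\<exists>c. \<not> colorable H (?L c)"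
    if "H \<in> BAD" for H
    using that closed_in_subset by (auto simp: BAD_def)
  have "BAD \<subseteq> Pow V" using BAD(1) by blast
  then have finBAD: "finite BAD" using finV finite_subset by blast
  define good where "good = (\<lambda>H S. S \<subseteq> H \<and> D \<le> card S \<and> (\<forall>v \<in> S. pnbr v \<in> P \<and> E v (pnbr v)) \<and>
      (\<forall>v \<in> S. \<exists>v' \<in> S. E v v' \<and> pnbr v \<noteq> pnbr v' \<and> conn (H - {v})))"
  define S where "S = (\<lambda>H. SOME S. good H S)"
  have good: "good H (S H)" if HB: "H \<in> BAD" for H
  proof -
    obtain c where c: "\<not> colorable H (?L c)" using BAD(5)[OF HB] by blast
    obtain S' where "S' \<subseteq> H" "D \<le> card S'" "\<And>v. v \<in> S' \<Longrightarrow> pnbr v \<in> P \<and> E v (pnbr v)"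
      "\<And>v. v \<in> S' \<Longrightarrow> \<exists>v' \<in> S'. E v v' \<and> pnbr v \<noteq> pnbr v' \<and> conn (H - {v})"
      by (rule bad_component[OF BAD(1-3)[OF HB] LD c no_gadget]) blast+
    then have "good H S'" by (simp add: good_def)
    then show ?thesis unfolding S_def by (rule someI)
  qed
  have S: "S H \<subseteq> H" "D \<le> card (S H)" "\<And>v. v \<in> S H \<Longrightarrow> pnbr v \<in> P \<and> E v (pnbr v)"
    "\<And>v. v \<in> S H \<Longrightarrow> \<exists>v' \<in> S H. E v v' \<and> pnbr v \<noteq> pnbr v' \<and> conn (H - {v})" if "H \<in> BAD" for H
    using good[OF that] by (simp_all add: good_def)
  have SV: "S H \<subseteq> V" "finite (S H)" if "H \<in> BAD" for H
    using S(1)[OF that] BAD(1)[OF that] finV finite_subset by (blast, metis finite_Diff)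
  have "\<exists>h. inj_on h BAD \<and> (\<forall>H \<in> BAD. h H \<in> pnbr ` S H)"
  proof (rule hall[OF finBAD])
    fix J assume J: "J \<subseteq> BAD"
    have finJ: "finite J" using J finBAD finite_subset by blast
    let ?N = "\<Union>H \<in> J. pnbr ` S H"
    have NP: "?N \<subseteq> P" using S(3) J by blast
    have finN: "finite ?N" using finite_subset[OF NP finP] .
    have disj: "S H \<inter> S H' = {}" if HH: "H \<in> J" "H' \<in> J" "H \<noteq> H'" for H H'
    proof -
      have "H \<in> BAD" "H' \<in> BAD" using HH J by auto
      then show ?thesis
        using components_eq[OF BAD(4,2) BAD(4,2), of H H'] S(1)[of H] S(1)[of H'] HH(3) by blast
    qed
    \<comment> \<open>Double counting of edges: the disjoint sets \<open>S H\<close> send at least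
      \<open>card J * D\<close> edges to \<open>?N\<close>, and each vertex of \<open>?N\<close>
      receives at most \<open>D\<close>.\<close>
    have "card J * D \<le> (\<Sum>H \<in> J. card (S H))"
      using sum_bounded_below[of J D "\<lambda>H. card (S H)"] S(2) J by auto
    also have "\<dots> = card (\<Union>H \<in> J. S H)"
      using finJ SV(2) J disj by (intro card_UN_disjoint[symmetric]) auto
    also have "\<dots> \<le> card (\<Union>q \<in> ?N. nbhd V q)"
    proof (rule card_mono)
      show "finite (\<Union>q \<in> ?N. nbhd V q)"
        by (rule finite_UN_I[OF finN]) (simp add: finV)
      show "(\<Union>H \<in> J. S H) \<subseteq> (\<Union>q \<in> ?N. nbhd V q)"
      proof
        fix v assume "v \<in> (\<Union>H \<in> J. S H)"
        then obtain H where H: "H \<in> J" "v \<in> S H" by blast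
        then have "v \<in> nbhd V (pnbr v)" using S(3)[of H v] J SV(1)[of H] sym by auto
        then show "v \<in> (\<Union>q \<in> ?N. nbhd V q)" using H by blast
      qed
    qed
    also have "\<dots> \<le> (\<Sum>q \<in> ?N. card (nbhd V q))"
      using finN by (rule card_UN_le)
    also have "\<dots> \<le> card ?N * D"
      using sum_bounded_above[of ?N "\<lambda>q. card (nbhd V q)" D] deg NP PV by auto
    finally show "card J \<le> card ?N" using D4 by simp
  qed (use SV(2) in blast)
  then obtain h where h: "inj_on h BAD" "\<forall>H \<in> BAD. h H \<in> pnbr ` S H" by blast
  define edge where "edge = (\<lambda>H (v, v'). v \<in> S H \<and> v' \<in> S H \<and> pnbr v = h H \<and> E v v' \<and>
      pnbr v \<noteq> pnbr v' \<and> conn (H - {v}))"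
  define e where "e = (\<lambda>H. SOME e. edge H e)"
  define a b where "a = (\<lambda>H. fst (e H))" and "b = (\<lambda>H. snd (e H))"
  have edge: "edge H (e H)" if HB: "H \<in> BAD" for H
  proof -
    have "h H \<in> pnbr ` S H" using h(2) HB by blast
    then obtain v where v: "v \<in> S H" "pnbr v = h H" by auto
    then obtain v' where "edge H (v, v')" using S(4)[OF HB v(1)] unfolding edge_def by blast
    then show ?thesis unfolding e_def by (rule someI)
  qed
  have ab: "a H \<in> S H" "b H \<in> S H" "pnbr (a H) = h H" "E (a H) (b H)"
    "pnbr (a H) \<noteq> pnbr (b H)" "conn (H - {a H})" if "H \<in> BAD" for H
    using edge[OF that] unfolding edge_def a_def b_def case_prod_beta by blast+
  \<comment> \<open>This is the necessary condition of \<open>bad_component_lists\<close> for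
    failure of \<open>H\<close>. Each of the two colours determines the other, so it is a partial
    matching.\<close>
  define R where "R = (\<lambda>H \<alpha> \<beta>. \<alpha> \<in> L (a H) \<and> \<beta> \<in> L (b H) \<and> L (a H) - {\<alpha>} = L (b H) - {\<beta>})"
  have "\<exists>c. (\<forall>p \<in> P. c p \<in> L p) \<and> (\<forall>H \<in> BAD. \<not> R H (c (h H)) (c (pnbr (b H))))"
  proof (rule conflict_coloring[OF finP finBAD h(1)])
    fix H assume H: "H \<in> BAD"
    show "h H \<in> P" "pnbr (b H) \<in> P" "h H \<noteq> pnbr (b H)"
      using S(3)[OF H ab(1)[OF H]] S(3)[OF H ab(2)[OF H]] ab(3,5)[OF H] by auto
  next
    fix H \<alpha> \<beta> \<beta>' assume "R H \<alpha> \<beta>" "R H \<alpha> \<beta>'"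
    then show "\<beta> = \<beta>'" unfolding R_def by blast
  next
    fix H \<alpha> \<alpha>' \<beta> assume "R H \<alpha> \<beta>" "R H \<alpha>' \<beta>"
    then show "\<alpha> = \<alpha>'" unfolding R_def by blast
  qed (use LP in auto)
  then obtain c where c: "\<forall>p \<in> P. c p \<in> L p" "\<forall>H \<in> BAD. \<not> R H (c (h H)) (c (pnbr (b H)))" by blast
  have "colorable (V - P) (?L c)"
  proof (rule ccontr)
    assume nc: "\<not> ?thesis"
    have "finite (V - P)" using finV by simp
    then obtain H where H: "closed_in (V - P) H" "H \<noteq> {}" "conn H" "\<not> colorable H (?L c)"
      using noncolorable_component[OF _ nc] by blast
    then have HB: "H \<in> BAD" by (auto simp: BAD_def)
    have "R H (c (pnbr (a H))) (c (pnbr (b H)))"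
      unfolding R_def
    proof (rule bad_component_lists[OF BAD(1,2)[OF HB] LD H(4)])
      show "a H \<in> H" "b H \<in> H" using ab(1,2)[OF HB] S(1)[OF HB] by auto
      show "E (a H) (b H)" "conn (H - {a H})" using ab(4,6)[OF HB] .
      show "pnbr (a H) \<in> P" "E (a H) (pnbr (a H))" "pnbr (b H) \<in> P" "E (b H) (pnbr (b H))"
        using S(3)[OF HB ab(1)[OF HB]] S(3)[OF HB ab(2)[OF HB]] by auto
    qed
    then show False using c(2) HB ab(3)[OF HB] by auto
  qed
  moreover have "colors P L c" using c(1) P_indep by (auto simp: colors_def)
  ultimately have "colorable (P \<union> (V - P)) L"
    by (intro colorable_extend[of P]) auto
  moreover have "P \<union> (V - P) = V" using PV by blast
  ultimately show ?thesis by simp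
qed

text \<open>At most one coloured vertex is adjacent to \<open>p\<close>, so two colours remain for
  \<open>p\<close>, and for a fixed \<open>w0\<close> at most one of them can block the gadget. As
  \<open>p\<close> and \<open>x\<close> are not adjacent, the choice does not change the list left
  at \<open>x\<close>.\<close>

lemma colorable_gadget_step:
  assumes g: "gadget p W x" and LD: "\<And>v. v \<in> V - P \<Longrightarrow> card (L v) = D" and LP: "3 \<le> card (L p)"
    and IH: "colorable (V - insert p (insert x W)) L"
  shows "colorable V L"
proof -
  note gd = gadgetD[OF g]
  define U where "U = V - insert p (insert x W)"
  have finU: "finite U" using finV by (simp add: U_def)
  obtain \<phi> where \<phi>: "colors U L \<phi>" using IH by (auto simp: colorable_def U_def)
  define Lp where "Lp = L p - \<phi> ` nbhd U p"
  define Lx where "Lx = L x - \<phi> ` nbhd U x"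
  have "nbhd U p \<subseteq> nbhd V p - W" by (auto simp: U_def)
  then have "card (nbhd U p) \<le> 1"
    using gadget_outer[OF g, of p] card_mono[of "nbhd V p - W" "nbhd U p"] finV by auto
  then have "2 \<le> card Lp"
    using card_diff_image_ge[of "nbhd U p" "L p" \<phi>] finU LP by (simp add: Lp_def)
  then obtain A where "A \<subseteq> Lp" "card A = 2" by (metis obtain_subset_with_card_n)
  then obtain a1 a2 where a12: "a1 \<in> Lp" "a2 \<in> Lp" "a1 \<noteq> a2"
    by (metis card_2_iff insert_subset)
  obtain w0 where w0: "w0 \<in> W" using gd(11) by blast
  have "\<exists>a \<in> Lp. a \<notin> L w0 \<or> Lx \<noteq> L w0 - {a}"
  proof (rule ccontr)
    assume "\<not> ?thesis"
    then have "a1 \<in> L w0" "a2 \<in> L w0" "L w0 - {a1} = L w0 - {a2}" using a12(1,2) by auto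
    then show False using a12(3) by blast
  qed
  then obtain a where a: "a \<in> Lp" "a \<notin> L w0 \<or> Lx \<noteq> L w0 - {a}" by blast
  define \<phi>' where "\<phi>' = \<phi>(p := a)"
  have \<phi>': "colors (insert p U) L \<phi>'"
    unfolding colors_def
  proof (intro conjI ballI impI)
    fix v assume "v \<in> insert p U"
    then show "\<phi>' v \<in> L v" using \<phi> a(1) by (auto simp: \<phi>'_def colors_def Lp_def)
  next
    fix u v assume uv: "u \<in> insert p U" "v \<in> insert p U" "E u v"
    have pU: "\<phi> v \<noteq> a" if "v \<in> U" "E p v" for v using a(1) that by (auto simp: Lp_def)
    show "\<phi>' u \<noteq> \<phi>' v"
    proof (cases "u = p")
      case True
      then have "v \<noteq> p" "v \<in> U" using uv irrefl by auto
      then show ?thesis using pU[of v] uv True by (auto simp: \<phi>'_def)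
    next
      case False
      then show ?thesis
        using pU[of u] uv sym[OF uv(3)] \<phi> by (cases "v = p") (auto simp: \<phi>'_def colors_def)
    qed
  qed
  have px: "\<not> E x p" using gd(8) sym by blast
  have eqx: "\<phi>' ` nbhd (insert p U) x = \<phi> ` nbhd U x"
  proof -
    have "nbhd (insert p U) x = nbhd U x" using px by auto
    moreover have "\<phi>' v = \<phi> v" if "v \<in> nbhd U x" for v using that by (auto simp: \<phi>'_def U_def)
    ultimately show ?thesis by (auto intro!: image_cong)
  qed
  have "insert p U \<subseteq> V" "insert p U \<inter> insert x W = {}" "p \<in> insert p U"
    using gd(4,9,12,13) by (auto simp: U_def)
  moreover have "card (L v) = D" if "v \<in> insert x W" for v using LD[of v] gd(2,3) that by auto
  moreover have "\<phi>' p \<notin> L w0 \<or> L x - \<phi>' ` nbhd (insert p U) x \<noteq> L w0 - {\<phi>' p}"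
    unfolding eqx using a(2) by (simp add: \<phi>'_def Lx_def)
  ultimately obtain \<psi> where "colors (insert p U \<union> insert x W) L \<psi>"
    using gadget_extend[OF g _ _ _ \<phi>' _ w0] by metis
  moreover have "insert p U \<union> insert x W = V" using gd(2,3,9) by (auto simp: U_def)
  ultimately show ?thesis by (auto simp: colorable_def)
qed

end

text \<open>This is placed in \<open>simple_graph\<close> because the induction that deletes gadgets
  varies both \<open>V\<close> and \<open>P\<close>.\<close>

lemma (in simple_graph) colorable_three:
  assumes "brooks_graph E D V P" "\<And>v. v \<in> V - P \<Longrightarrow> card (L v) = D"
    and "\<And>p. p \<in> P \<Longrightarrow> 3 \<le> card (L p)"
  shows "colorable V L"
  using assms
proof (induction "card V" arbitrary: V P rule: less_induct)
  case less
  interpret brooks_graph E D V P using less.prems(1) .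
  show ?case
  proof (cases "\<exists>p W x. gadget p W x")
    case True
    then obtain p W x where g: "gadget p W x" by blast
    let ?U = "V - insert p (insert x W)"
    have "card ?U < card V"
      using gadgetD(9)[OF g] finV by (intro psubset_card_mono) auto
    moreover have "brooks_graph E D ?U (P \<inter> ?U)" by (rule brooks_graph_subset) auto
    ultimately have "colorable ?U L"
      using less.hyps[of ?U "P \<inter> ?U"] less.prems(2,3) by blast
    then show ?thesis
      using less.prems(2,3) gadgetD(1)[OF g] by (intro colorable_gadget_step[OF g]) auto
  next
    case False
    then show ?thesis using less.prems(2,3) by (intro colorable_without_gadgets) auto
  qed
qed

section \<open>Lists of size two\<close>

context brooks_graph
begin

text \<open>Two disjoint sets of \<open>D - 1\<close> neighbours do not fit into the neighbourhood
  of \<open>p\<close>. The neighbourhood of a common vertex recovers the block, and \<open>x\<close>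
  is its only vertex not adjacent to \<open>p\<close>.\<close>

lemma gadget_unique:
  assumes g: "gadget p W x" and g': "gadget p W' x'"
  shows "W' = W" "x' = x"
proof -
  note gd = gadgetD[OF g] and gd' = gadgetD[OF g']
  have "W \<inter> W' \<noteq> {}"
  proof
    assume "W \<inter> W' = {}"
    then have "card (W \<union> W') = (D - 1) + (D - 1)"
      using gd(5,10) gd'(5,10) by (simp add: card_Un_disjoint)
    moreover have "card (W \<union> W') \<le> card (nbhd V p)"
      using gd(2,7) gd'(2,7) finV by (intro card_mono) auto
    ultimately show False using deg[OF gd(9)] D4 by simp
  qed
  then obtain w where w: "w \<in> W" "w \<in> W'" by blast
  have "insert x W = insert w (nbhd V w) - {p}" if "gadget p W x" "w \<in> W" for W x
    using gadget_nbhd[OF that] gadgetD(12,13)[OF that(1)] that(2) by auto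
  from this[OF g w(1)] this[OF g' w(2)] have eq: "insert x W = insert x' W'" by simp
  have "x \<notin> W'" using gd(8) gd'(7) by blast
  moreover have "x \<in> insert x' W'" unfolding eq[symmetric] by simp
  ultimately show x: "x' = x" by simp
  have "W' = insert x' W' - {x'}" "W = insert x W - {x}" using gd(4) gd'(4) by simp_all
  then show "W' = W" unfolding x eq by simp
qed

text \<open>If \<open>L p\<close> is not contained in \<open>L x\<close>, some colour of \<open>p\<close> never blocks the gadget.\<close>

lemma safe_color:
  assumes g: "gadget p W x" and "\<not> L p \<subseteq> L x" "2 \<le> card (L p)"
  obtains a where "a \<in> L p" "\<And>K. K \<subseteq> L x \<Longrightarrow> \<exists>w0 \<in> W. a \<notin> L w0 \<or> K \<noteq> L w0 - {a}"
proof -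
  obtain a where a: "a \<in> L p" "a \<notin> L x" using assms(2) by blast
  show thesis
  proof (cases "\<exists>w0 \<in> W. a \<notin> L w0")
    case True
    then show ?thesis using that[OF a(1)] by blast
  next
    case False
    \<comment> \<open>If \<open>a\<close> is in every list on \<open>W\<close>, another colour
      \<open>b\<close> is used for \<open>p\<close>: then \<open>a\<close> survives in
      \<open>L w0 - {b}\<close> but lies in no subset of \<open>L x\<close>.\<close>
    obtain w0 where w0: "w0 \<in> W" using gadgetD(11)[OF g] by blast
    have "\<not> L p \<subseteq> {a}" using assms(3) card_mono[of "{a}" "L p"] by auto
    then obtain b where b: "b \<in> L p" "b \<noteq> a" by blast
    have "a \<in> L w0 - {b}" using False w0 b by auto
    then have "K \<noteq> L w0 - {b}" if "K \<subseteq> L x" for K using a(2) that by blast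
    then show ?thesis using that[OF b(1)] w0 by blast
  qed
qed

end

locale brooks_far = brooks_graph E D V P for E :: "'a \<Rightarrow> 'a \<Rightarrow> bool" and D V P +
  fixes L :: "'a \<Rightarrow> 'c set"
  assumes LD: "v \<in> V - P \<Longrightarrow> card (L v) = D"
    and LP: "p \<in> P \<Longrightarrow> 2 \<le> card (L p)"
    and P_far: "v \<in> V \<Longrightarrow> w \<in> V \<Longrightarrow> p \<in> P \<Longrightarrow> q \<in> P \<Longrightarrow> E p v \<Longrightarrow> E v w \<Longrightarrow> E w q \<Longrightarrow> p = q"
begin

section \<open>Position of gadgets when vertices of \<open>P\<close> are at distance at least
  four\<close>

definition owners :: "'a set" where
  "owners = {p. \<exists>W x. gadget p W x}"

definition gW :: "'a \<Rightarrow> 'a set" where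
  "gW p = (SOME W. \<exists>x. gadget p W x)"

definition gX :: "'a \<Rightarrow> 'a" where
  "gX p = (SOME x. gadget p (gW p) x)"

lemma gadget_own: "p \<in> owners \<Longrightarrow> gadget p (gW p) (gX p)"
  unfolding owners_def gW_def gX_def by (metis (mono_tags, lifting) mem_Collect_eq someI_ex)

lemma owners_P: "owners \<subseteq> P"
  using gadgetD(1) by (auto simp: owners_def)

text \<open>The walk from \<open>p\<close> through a vertex of \<open>gW p\<close> and
  \<open>gX p\<close> to \<open>q\<close> has length three, which forces \<open>q = p\<close>; but
  \<open>p\<close> is not adjacent to \<open>gX p\<close>.\<close>

lemma gX_notP_adj:
  assumes "p \<in> owners" "q \<in> P"
  shows "\<not> E (gX p) q"
proof
  assume xq: "E (gX p) q"
  note g = gadget_own[OF assms(1)]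
  obtain w where w: "w \<in> gW p" using gadgetD(11)[OF g] by blast
  have "w \<in> V" "gX p \<in> V" using gadgetD(2,3)[OF g] w by auto
  moreover have "E w (gX p)" using gadget_adj[OF g w] sym by blast
  ultimately have "p = q"
    using P_far[of w "gX p" p q] gadgetD(1)[OF g] gadgetD(7)[OF g w] assms(2) xq by blast
  then show False using xq gadgetD(8)[OF g] sym by blast
qed

text \<open>A common vertex of \<open>gW p\<close> and \<open>gW q\<close> would see two vertices of
  \<open>P\<close>; \<open>gX p\<close> in \<open>gW q\<close> would be adjacent to
  \<open>q\<close>; and a common \<open>gX\<close> would have \<open>2 * (D - 1) > D\<close>
  neighbours.\<close>

lemma gadgets_disjoint:
  assumes "p \<in> owners" "q \<in> owners" "p \<noteq> q"
  shows "gW p \<inter> gW q = {}" "gX p \<notin> gW q" "gX p \<noteq> gX q"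
proof -
  note g = gadgetD[OF gadget_own[OF assms(1)]] and g' = gadgetD[OF gadget_own[OF assms(2)]]
  show dis: "gW p \<inter> gW q = {}"
  proof (rule ccontr)
    assume "\<not> ?thesis"
    then obtain w where w: "w \<in> gW p" "w \<in> gW q" by blast
    then have "E w p" "E w q" "w \<in> V" using g(2) g(7)[of w] g'(7)[of w] sym by auto
    then show False using P_dist[of w p q] g(1) g'(1) assms(3) by blast
  qed
  show "gX p \<notin> gW q"
    using gX_notP_adj[OF assms(1) g'(1)] g'(7)[of "gX p"] sym by blast
  show "gX p \<noteq> gX q"
  proof
    assume eq: "gX p = gX q"
    have "gW p \<union> gW q \<subseteq> nbhd V (gX p)"
      using gadget_adj[OF gadget_own[OF assms(1)]] gadget_adj[OF gadget_own[OF assms(2)]]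
        g(2) g'(2) unfolding eq by auto
    then have "card (gW p \<union> gW q) \<le> D"
      using deg[of "gX p"] card_mono[of "nbhd V (gX p)"] finV g(3)
      by (meson DiffD1 finite_nbhd le_trans)
    moreover have "card (gW p \<union> gW q) = (D - 1) + (D - 1)"
      using g(5,10) g'(5,10) dis by (simp add: card_Un_disjoint)
    ultimately show False using D4 by simp
  qed
qed

section \<open>The reduced graph\<close>

text \<open>Here \<open>gX p\<close> may copy whatever colour \<open>p\<close> receives. For the
  remaining owners \<open>safe_color\<close> supplies a colour that never blocks the gadget.\<close>

definition tight :: "'a set" where
  "tight = {p \<in> owners. L p \<subseteq> L (gX p)}"

definition core :: "'a set" where
  "core = V - P - (\<Union>p \<in> owners. insert (gX p) (gW p))"

text \<open>
  In the reduced graph \<open>gW p\<close> is deleted and \<open>gX p\<close> is identified with \<open>p\<close>, for each tight \<open>p\<close>.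
\<close>

definition rep :: "'a \<Rightarrow> 'a set" where
  "rep v = (if v \<in> tight then {v, gX v} else {v})"

definition E' :: "'a \<Rightarrow> 'a \<Rightarrow> bool" where
  "E' u v \<longleftrightarrow> (\<exists>u' \<in> rep u. \<exists>v' \<in> rep v. E u' v')"

lemma tight_owners: "p \<in> tight \<Longrightarrow> p \<in> owners"
  by (simp add: tight_def)

lemma tight_P: "p \<in> tight \<Longrightarrow> p \<in> P"
  using tight_owners owners_P by blast

lemma simple_graph_E': "simple_graph E'"
proof
  show "E' v u" if uv: "E' u v" for u v
  proof -
    obtain u' v' where "u' \<in> rep u" "v' \<in> rep v" "E u' v'" using uv unfolding E'_def by blast
    then show ?thesis unfolding E'_def using sym[of u' v'] by blast
  qed
  show "\<not> E' u u" for u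
  proof
    assume "E' u u"
    then obtain a b where ab: "a \<in> rep u" "b \<in> rep u" "E a b" unfolding E'_def by blast
    have "a \<noteq> b" using ab(3) irrefl by blast
    then have u: "u \<in> tight" "E u (gX u) \<or> E (gX u) u"
      using ab by (auto simp: rep_def split: if_splits)
    then show False
      using gadgetD(8)[OF gadget_own[OF tight_owners]] sym by blast
  qed
qed

sublocale G': simple_graph E'
  by (rule simple_graph_E')

lemma rep_inj:
  assumes "u \<in> core \<union> tight" "v \<in> core \<union> tight" "y \<in> rep u" "y \<in> rep v"
  shows "u = v"
proof -
  have not_gX: "u \<noteq> gX p" if "p \<in> tight" "u \<in> core \<union> tight" for u p
  proof -
    have "gX p \<notin> core" using tight_owners[OF that(1)] by (auto simp: core_def)
    moreover have "gX p \<notin> tight"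
      using gadgetD(3)[OF gadget_own[OF tight_owners[OF that(1)]]] tight_P by blast
    ultimately show ?thesis using that(2) by blast
  qed
  have "gX p \<noteq> gX q" if "p \<in> tight" "q \<in> tight" "p \<noteq> q" for p q
    using gadgets_disjoint(3) tight_owners that by blast
  then show ?thesis
    using assms not_gX[of u v] not_gX[of v u] by (auto simp: rep_def split: if_splits)
qed

lemma core_V: "core \<subseteq> V - P"
  by (auto simp: core_def)

lemma rep_V:
  assumes "u \<in> core \<union> tight" "y \<in> rep u"
  shows "y \<in> V - (P - tight)"
proof (cases "u \<in> tight")
  case True
  then have "gX u \<in> V - P" "u \<in> V"
    using gadgetD(3,9)[OF gadget_own[OF tight_owners[OF True]]] by auto
  then show ?thesis using True assms(2) by (auto simp: rep_def)
next
  case False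
  then show ?thesis using assms core_V by (auto simp: rep_def)
qed

lemma rep_core: "v \<in> core \<Longrightarrow> rep v = {v}"
  using core_V tight_P by (auto simp: rep_def)

text \<open>Since distinct vertices have disjoint sets \<open>rep\<close>, neighbours of
  \<open>v\<close> in the reduced graph are witnessed by distinct neighbours in
  \<open>V - (P - tight)\<close>. The edges to \<open>P - tight\<close> account for the removed
  colours.\<close>

lemma deg_core:
  assumes v: "v \<in> core"
  shows "card (G'.nbhd (core \<union> tight) v) \<le> card (L v - c ` nbhd (P - tight) v)"
proof -
  define m where "m = (\<lambda>u. SOME y. y \<in> rep u \<and> E v y)"
  have m: "m u \<in> rep u \<and> E v (m u)" if "u \<in> G'.nbhd (core \<union> tight) v" for u
  proof -
    have "E' v u" using that by simp
    then obtain y where "y \<in> rep u \<and> E v y" unfolding E'_def rep_core[OF v] by blast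
    then show ?thesis unfolding m_def by (rule someI)
  qed
  have "card (G'.nbhd (core \<union> tight) v) \<le> card (nbhd (V - (P - tight)) v)"
  proof (rule card_inj_on_le[of m])
    show "inj_on m (G'.nbhd (core \<union> tight) v)"
    proof (rule inj_onI)
      fix a b assume ab: "a \<in> G'.nbhd (core \<union> tight) v" "b \<in> G'.nbhd (core \<union> tight) v" "m a = m b"
      then show "a = b" using rep_inj[of a b "m a"] m[OF ab(1)] m[OF ab(2)] by simp
    qed
    show "m ` G'.nbhd (core \<union> tight) v \<subseteq> nbhd (V - (P - tight)) v"
    proof
      fix y assume "y \<in> m ` G'.nbhd (core \<union> tight) v"
      then obtain u where u: "u \<in> G'.nbhd (core \<union> tight) v" "y = m u" by blast
      then show "y \<in> nbhd (V - (P - tight)) v" using m[OF u(1)] rep_V[of u "m u"] by simp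
    qed
  qed (use finV in simp)
  also have "\<dots> \<le> card (L v - c ` nbhd (P - tight) v)"
  proof (rule card_residual_ge)
    show "v \<in> V - (P - tight)" "card (L v) = D" using v core_V LD by auto
  qed (use PV in auto)
  finally show ?thesis .
qed

text \<open>An edge at the merged vertex stems from an edge at \<open>p\<close> or
  \<open>gX p\<close> that leaves the gadget. From \<open>p\<close> it cannot reach another merged
  vertex, because \<open>P\<close> is independent and no \<open>gX q\<close> has a neighbour in
  \<open>P\<close>.\<close>

lemma nbrs_tight:
  assumes p: "p \<in> tight" and u: "u \<in> core \<union> tight" "E' p u"
  shows "u \<in> core \<and> u \<in> nbhd V p - gW p \<or> (\<exists>y \<in> rep u. y \<in> nbhd V (gX p) - gW p)"
proof -
  note po = tight_owners[OF p]
  note g = gadgetD[OF gadget_own[OF po]]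
  obtain p' y where py: "p' \<in> rep p" "y \<in> rep u" "E p' y" using u(2) unfolding E'_def by blast
  have yV: "y \<in> V" using rep_V[OF u(1) py(2)] by blast
  have ygW: "y \<notin> gW p"
  proof
    assume y: "y \<in> gW p"
    show False
    proof (cases "u \<in> tight")
      case True
      then have "y = gX u" using py(2) y g(2) tight_P by (auto simp: rep_def)
      then show False
        using y gadgets_disjoint(2)[OF tight_owners[OF True] po] g(4) by auto
    next
      case False
      then show False using py(2) y u(1) po by (auto simp: rep_def core_def)
    qed
  qed
  show ?thesis
  proof (cases "p' = p")
    case True
    have "u \<notin> tight"
    proof
      assume ut: "u \<in> tight"
      then have "y = u \<or> y = gX u" using py(2) by (simp add: rep_def)
      then show False
        using py(3) True P_indep[OF g(1) tight_P[OF ut]] gX_notP_adj[OF tight_owners[OF ut] g(1)] sym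
        by blast
    qed
    then have "y = u" "u \<in> core" using py(2) u(1) by (auto simp: rep_def)
    then show ?thesis using py(3) True yV ygW by simp
  next
    case False
    then have "p' = gX p" using py(1) p by (simp add: rep_def)
    then have "y \<in> nbhd V (gX p) - gW p" using py(3) yV ygW by simp
    then show ?thesis using py(2) by blast
  qed
qed

lemma gX_side_unique:
  assumes p: "p \<in> tight" and u: "u \<in> core \<union> tight" "u' \<in> core \<union> tight"
    and y: "y \<in> rep u" "y \<in> nbhd V (gX p) - gW p" "y' \<in> rep u'" "y' \<in> nbhd V (gX p) - gW p"
  shows "u = u'"
proof -
  have "card (nbhd V (gX p) - gW p) \<le> 1"
    using gadget_outer[OF gadget_own[OF tight_owners[OF p]]] by blast
  then have "y = y'" using y(2,4) finV by (auto simp: card_le_Suc0_iff_eq)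
  then show ?thesis using rep_inj[OF u y(1)] y(3) by blast
qed

text \<open>By \<open>gadget_outer\<close>, at most one neighbour arises through \<open>p\<close>
  and at most one through \<open>gX p\<close>.\<close>

lemma deg_tight:
  assumes p: "p \<in> tight"
  shows "card (G'.nbhd (core \<union> tight) p) \<le> 2"
proof -
  let ?A = "nbhd V p - gW p"
  let ?B = "{u \<in> core \<union> tight. \<exists>y \<in> rep u. y \<in> nbhd V (gX p) - gW p}"
  have "card ?A \<le> 1" using gadget_outer[OF gadget_own[OF tight_owners[OF p]]] by blast
  moreover have finC: "finite (core \<union> tight)"
    using core_V tight_P PV finV finite_subset[of "core \<union> tight" V] by blast
  then have "card ?B \<le> 1"
    using gX_side_unique[OF p] by (auto simp: card_le_Suc0_iff_eq)
  moreover have "G'.nbhd (core \<union> tight) p \<subseteq> ?A \<union> ?B"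
  proof
    fix u assume "u \<in> G'.nbhd (core \<union> tight) p"
    then show "u \<in> ?A \<union> ?B" using nbrs_tight[OF p, of u] by auto
  qed
  then have "card (G'.nbhd (core \<union> tight) p) \<le> card (?A \<union> ?B)"
    using finC finV by (intro card_mono) auto
  ultimately show ?thesis using card_Un_le[of ?A ?B] by linarith
qed

lemma core_adj: "u \<in> core \<Longrightarrow> v \<in> core \<Longrightarrow> E' u v \<longleftrightarrow> E u v"
  by (simp add: E'_def rep_core)

lemma finite_L: "v \<in> V \<Longrightarrow> finite (L v)"
  using LD[of v] LP[of v] D4 card.infinite[of "L v"] by (cases "v \<in> P") fastforce+

text \<open>An uncolourable component has a tight end block. If \<open>W\<close> meets
  \<open>core\<close>, the block is a clique whose vertices in \<open>W\<close> share a neighbour in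
  \<open>P\<close> by \<open>P_far\<close>; this is a gadget, which \<open>core\<close> avoids.
  Otherwise the block has degree two, and two merged vertices of \<open>W\<close> are both adjacent
  to \<open>x\<close>, against \<open>P_dist\<close>.\<close>

lemma reduced_colorable: "G'.colorable (core \<union> tight) (\<lambda>v. L v - c ` nbhd (P - tight) v)"
proof (rule ccontr)
  let ?L = "\<lambda>v. L v - c ` nbhd (P - tight) v"
  let ?V = "core \<union> tight"
  assume nc: "\<not> G'.colorable ?V ?L"
  have VV: "?V \<subseteq> V" using core_V tight_P PV by blast
  have finC: "finite ?V" using finite_subset[OF VV finV] .
  have finP: "finite P" using finite_subset[OF PV finV] .
  have Lt: "?L p = L p" if "p \<in> tight" for p
  proof -
    have "nbhd (P - tight) p = {}" using P_indep tight_P[OF that] by auto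
    then show ?thesis by simp
  qed
  have Lc: "D - 1 \<le> card (?L v)" "card (?L v) \<le> D" "card (?L v) = D \<or> nbhd (P - tight) v \<noteq> {}"
    if "v \<in> core" for v
  proof -
    have v: "v \<in> V - P" "v \<in> V" using that core_V by auto
    show "D - 1 \<le> card (?L v)"
      using card_diff_image_ge[of "nbhd (P - tight) v" "L v" c] finP
        card_nbhd_P[of "P - tight" v] v LD[OF v(1)] by simp
    show "card (?L v) \<le> D"
      using LD[OF v(1)] card_mono[OF finite_L[OF v(2)], of "?L v"] by auto
    show "card (?L v) = D \<or> nbhd (P - tight) v \<noteq> {}"
      using LD[OF v(1)] by (cases "nbhd (P - tight) v = {}") simp_all
  qed
  have L2: "2 \<le> card (?L v)" if "v \<in> ?V" for v
  proof (cases "v \<in> tight")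
    case True
    then show ?thesis using Lt LP tight_P by simp
  next
    case False
    then have "v \<in> core" using that by blast
    then show ?thesis using Lc(1)[of v] D4 by linarith
  qed
  have dg0: "card (G'.nbhd ?V v) \<le> card (?L v)" if "v \<in> ?V" for v
  proof (cases "v \<in> tight")
    case True
    then show ?thesis using deg_tight[OF True] L2[OF that] by linarith
  next
    case False
    then show ?thesis using deg_core that by blast
  qed
  obtain K where K: "G'.closed_in ?V K" "K \<noteq> {}" "G'.conn K" "\<not> G'.colorable K ?L"
    by (rule G'.noncolorable_component[OF finC nc])
  have KV: "K \<subseteq> ?V" using G'.closed_in_subset[OF K(1)] .
  have finK: "finite K" using finite_subset[OF KV finC] .
  have nbK: "card (G'.nbhd S v) \<le> card (G'.nbhd ?V v)" if "S \<subseteq> ?V" for S v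
    using G'.card_nbhd_mono[OF finC that] .
  have dg: "card (G'.nbhd K v) \<le> card (?L v)" if "v \<in> K" for v
    using nbK[OF KV, of v] dg0[of v] that KV by auto
  have finL: "finite (?L v)" if "v \<in> K" for v
    using finite_L[of v] that KV VV by auto
  obtain r where r: "r \<in> K" using K(2) by blast
  have "K \<noteq> {r}"
  proof
    assume Kr: "K = {r}"
    have "card (?L r) \<noteq> 0" using L2[of r] r KV by auto
    then obtain a where "a \<in> ?L r" by (metis card.empty ex_in_conv)
    then have "G'.colors K ?L (\<lambda>_. a)" using Kr G'.irrefl by (auto simp: G'.colors_def)
    then show False using K(4) by (auto simp: G'.colorable_def)
  qed
  then have W0: "K - {r} \<noteq> {}" "K - {r} \<noteq> K" "G'.attached K (K - {r}) r"
    using r by (auto simp: G'.attached_def)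
  obtain x W s where W: "W \<subseteq> K - {r}" "G'.leaf K x W"
    "\<And>v. v \<in> insert x W \<Longrightarrow> card (G'.nbhd (insert x W) v) = s"
    "\<And>v. v \<in> W \<Longrightarrow> card (G'.nbhd K v) = s" "\<And>v. v \<in> W \<Longrightarrow> card (?L v) = s"
    "3 \<le> s \<Longrightarrow> G'.clique (insert x W)"
    by (rule G'.tight_leaf[OF finK K(3) dg finL K(4) Diff_subset W0]) blast+
  have WK: "insert x W \<subseteq> K" "x \<notin> W" "W \<noteq> {}"
    using G'.leaf_subset[OF W(2)] G'.leafD[OF W(2)] by auto
  have WV: "insert x W \<subseteq> ?V" using WK(1) KV by blast
  show False
  proof (cases "W \<subseteq> tight")
    case False
    then obtain w where w: "w \<in> W" "w \<in> core" using WV by blast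
    have s: "D - 1 \<le> s" "s \<le> D" using Lc(1,2)[OF w(2)] W(5)[OF w(1)] by auto
    \<comment> \<open>Merged vertices have degree at most two, but every vertex of this block has
      degree \<open>s \<ge> D - 1\<close>.\<close>
    have "v \<in> core" if v: "v \<in> insert x W" for v
    proof (rule ccontr)
      assume "v \<notin> core"
      then have "v \<in> tight" using v WV by blast
      then have "card (G'.nbhd ?V v) \<le> 2" by (rule deg_tight)
      then show False using nbK[OF WV, of v] W(3)[OF v] s(1) D4 by simp
    qed
    then have Bc: "insert x W \<subseteq> core" by blast
    have cl': "G'.clique (insert x W)" using W(6) s D4 by linarith
    have cl: "clique (insert x W)"
      unfolding clique_def
    proof (intro ballI impI)
      fix u v assume uv: "u \<in> insert x W" "v \<in> insert x W" "u \<noteq> v"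
      then have "E' u v" using cl' by (simp only: G'.clique_def) blast
      moreover have "u \<in> core" "v \<in> core" using uv Bc by auto
      ultimately show "E u v" using core_adj by blast
    qed
    have BV: "insert x W \<subseteq> V - P" using Bc core_V by blast
    have "nbhd (insert x W) w = G'.nbhd (insert x W) w"
    proof (rule set_eqI)
      fix u
      show "u \<in> nbhd (insert x W) w \<longleftrightarrow> u \<in> G'.nbhd (insert x W) w"
        using core_adj[OF w(2), of u] Bc by auto
    qed
    then have "card (nbhd (insert x W) w) = s" using W(3)[of w] w(1) by simp
    then have "card (insert x W) = s + 1" "s \<noteq> D"
      using clique_card_ne[OF cl _ _, of w s] BV w(1) by blast+
    then have sD: "s = D - 1" "card (insert x W) = D" using s D4 by auto
    have finW: "finite W" using finite_subset[OF WK(1) finK] by simp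
    have cW: "card W = D - 1" using sD(2) WK(2) finW by simp
    have ex: "\<exists>q \<in> P - tight. E v q" if "v \<in> W" for v
    proof -
      have "v \<in> core" using that Bc by blast
      moreover have "card (?L v) \<noteq> D" using W(5)[OF that] sD(1) D4 by linarith
      ultimately have "nbhd (P - tight) v \<noteq> {}" using Lc(3)[of v] by blast
      then obtain q where "q \<in> nbhd (P - tight) v" by blast
      then show ?thesis by auto
    qed
    obtain p where p: "p \<in> P - tight" "E w p" using ex[OF w(1)] by blast
    have "gadget p W x"
    proof (rule clique_gadget[OF cl BV WK(2) cW])
      show "p \<in> P" using p by blast
      fix v assume v: "v \<in> W"
      obtain q where q: "q \<in> P - tight" "E v q" using ex[OF v] by blast
      show "E p v"
      proof (cases "v = w")
        case True
        then show ?thesis using p(2) sym by blast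
      next
        case False
        then have "E w v" using cl v w(1) by (simp add: clique_def)
        moreover have "w \<in> V" "v \<in> V" using BV v w(1) by auto
        ultimately have "p = q" using P_far[of w v p q] p q sym[OF p(2)] by blast
        then show ?thesis using q(2) sym by blast
      qed
    qed
    moreover from this have po: "p \<in> owners" by (auto simp: owners_def)
    ultimately have "gW p = W" using gadget_unique(1)[OF _ gadget_own[OF po]] by blast
    then show False using w po by (auto simp: core_def)
  next
    case True
    obtain w where w: "w \<in> W" using WK(3) by blast
    have wt: "w \<in> tight" using True w by blast
    have "2 \<le> s" using L2[of w] W(5)[OF w] w WV by auto
    moreover have "s \<le> 2" using deg_tight[OF wt] nbK[OF KV, of w] W(4)[OF w] by linarith
    ultimately have s: "s = 2" by simp
    \<comment> \<open>The edge to \<open>gX q\<close> is the only one leaving the gadget at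
      \<open>gX p\<close>. The second neighbour of \<open>p\<close> in the block is thus reached
      from \<open>p\<close> itself, lies in \<open>core\<close>, and can only be
      \<open>x\<close>.\<close>
    have adj_x: "E p x" if p: "p \<in> W" and q: "q \<in> W" "E (gX p) (gX q)" for p q
    proof -
      have pt: "p \<in> tight" "q \<in> tight" using p q(1) True by auto
      note go = gadget_own[OF tight_owners[OF pt(1)]]
      have "card (G'.nbhd (insert x W) p) = 2" using W(3)[of p] p s by simp
      then have "\<not> G'.nbhd (insert x W) p \<subseteq> {q}"
        using card_mono[of "{q}" "G'.nbhd (insert x W) p"] by auto
      then obtain y where y: "y \<in> G'.nbhd (insert x W) p" "y \<noteq> q" by blast
      have yV: "y \<in> ?V" "E' p y" using y(1) WV by auto
      have "q \<noteq> p" using q(2) irrefl by blast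
      then have qn: "gX q \<in> nbhd V (gX p) - gW p"
        using q(2) gadgetD(3)[OF gadget_own[OF tight_owners[OF pt(2)]]]
          gadgets_disjoint(2)[OF tight_owners[OF pt(2)] tight_owners[OF pt(1)]] by auto
      have "gX q \<in> rep q" using pt(2) by (simp add: rep_def)
      then have "\<not> (\<exists>z \<in> rep y. z \<in> nbhd V (gX p) - gW p)"
        using gX_side_unique[OF pt(1) yV(1), of q] qn pt(2) y(2) by blast
      then have "y \<in> core" "E p y" using nbrs_tight[OF pt(1) yV] by auto
      moreover have "y \<notin> tight" using \<open>y \<in> core\<close> core_V tight_P by blast
      ultimately show ?thesis using y(1) True by auto
    qed
    have "card (G'.nbhd (insert x W) w) = 2" using W(3)[of w] w s by simp
    then have "\<not> G'.nbhd (insert x W) w \<subseteq> {x}"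
      using card_mono[of "{x}" "G'.nbhd (insert x W) w"] by auto
    then obtain q where "q \<in> G'.nbhd (insert x W) w" "q \<noteq> x" by blast
    then have q: "q \<in> W" "E' w q" by auto
    have qt: "q \<in> tight" using q(1) True by blast
    \<comment> \<open>Of the four possible edges behind \<open>E' w q\<close>, those with an end
      \<open>w\<close> or \<open>q\<close> are excluded by the distances in
      \<open>P\<close>.\<close>
    have wq: "E (gX w) (gX q)"
    proof -
      obtain a b where ab: "a \<in> rep w" "b \<in> rep q" "E a b" using q(2) unfolding E'_def by blast
      have "a = w \<or> a = gX w" "b = q \<or> b = gX q" using ab(1,2) wt qt by (auto simp: rep_def)
      moreover have "\<not> E w q" using P_indep tight_P wt qt by blast
      moreover have "\<not> E w (gX q)" using gX_notP_adj[OF tight_owners[OF qt] tight_P[OF wt]] sym by blast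
      moreover have "\<not> E (gX w) q" using gX_notP_adj[OF tight_owners[OF wt] tight_P[OF qt]] .
      ultimately show ?thesis using ab(3) by blast
    qed
    have "E w x" "E q x" using adj_x[OF w q(1) wq] adj_x[OF q(1) w sym[OF wq]] by auto
    then have "E x w" "E x q" using sym by auto
    then have "w = q" using P_dist[of x w q] tight_P[OF wt] tight_P[OF qt] WV VV by blast
    then show False using wq irrefl by blast
  qed
qed

section \<open>Lifting a colouring of the reduced graph\<close>

text \<open>First \<open>P - tight\<close> is coloured by \<open>c\<close>, then the reduced graph.
  Each tight \<open>p\<close> passes its colour to \<open>gX p\<close>, and the uncoloured rest of
  the gadgets is added one gadget at a time.\<close>

lemma colorable_far: "colorable V L"
proof -
  \<comment> \<open>The colour has to work for every \<open>K\<close>, since the list that will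
    remain at \<open>gX p\<close> depends on colours chosen later.\<close>
  define good where "good = (\<lambda>p a. a \<in> L p \<and> (p \<in> owners - tight \<longrightarrow>
    (\<forall>K \<subseteq> L (gX p). \<exists>w0 \<in> gW p. a \<notin> L w0 \<or> K \<noteq> L w0 - {a})))"
  define c where "c = (\<lambda>p. SOME a. good p a)"
  have c: "good p (c p)" if p: "p \<in> P" for p
  proof -
    have "\<exists>a. good p a"
    proof (cases "p \<in> owners - tight")
      case True
      then have po: "p \<in> owners" and nsub: "\<not> L p \<subseteq> L (gX p)" by (simp_all add: tight_def)
      obtain a where "a \<in> L p" "\<And>K. K \<subseteq> L (gX p) \<Longrightarrow> \<exists>w0 \<in> gW p. a \<notin> L w0 \<or> K \<noteq> L w0 - {a}"
        by (rule safe_color[OF gadget_own[OF po] nsub LP[OF p]]) blast+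
      then show ?thesis unfolding good_def by blast
    next
      case False
      have "L p \<noteq> {}" using LP[OF p] by auto
      then show ?thesis using False unfolding good_def by blast
    qed
    then show ?thesis unfolding c_def by (rule someI_ex)
  qed
  let ?Q = "P - tight"
  obtain \<phi>' where \<phi>': "G'.colors (core \<union> tight) (\<lambda>v. L v - c ` nbhd ?Q v) \<phi>'"
    using reduced_colorable unfolding G'.colorable_def by blast
  have \<phi>'_list: "\<phi>' v \<in> L v - c ` nbhd ?Q v" if "v \<in> core \<union> tight" for v
    using \<phi>' that by (simp add: G'.colors_def)
  have \<phi>'_adj: "\<phi>' u \<noteq> \<phi>' v" if "u \<in> core \<union> tight" "v \<in> core \<union> tight" "E' u v" for u v
    using \<phi>' that by (simp add: G'.colors_def)
  \<comment> \<open>This sends a vertex to the vertex of the reduced graph into which it is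
    merged.\<close>
  define \<rho> where "\<rho> = (\<lambda>v. if v \<in> gX ` tight then inv_into tight gX v else v)"
  define U0 where "U0 = core \<union> tight \<union> gX ` tight \<union> ?Q"
  define \<phi>0 where "\<phi>0 = (\<lambda>v. if v \<in> ?Q then c v else \<phi>' (\<rho> v))"
  have injX: "inj_on gX tight"
    using gadgets_disjoint(3) tight_owners by (intro inj_onI) blast
  have gXV: "gX p \<in> V - P" "gX p \<notin> core" if "p \<in> owners" for p
    using gadgetD(3)[OF gadget_own[OF that]] that by (auto simp: core_def)
  have \<rho>X: "\<rho> (gX p) = p" if "p \<in> tight" for p
    using that injX by (simp add: \<rho>_def)
  have \<rho>V: "\<rho> v = v" if "v \<in> core \<union> tight" for v
  proof -
    have "v \<notin> gX ` tight" using that gXV tight_owners tight_P by blast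
    then show ?thesis by (simp add: \<rho>_def)
  qed
  have \<rho>: "\<rho> v \<in> core \<union> tight \<and> v \<in> rep (\<rho> v)" if "v \<in> U0 - ?Q" for v
  proof (cases "v \<in> gX ` tight")
    case True
    then show ?thesis using \<rho>X by (auto simp: rep_def)
  next
    case False
    then have "v \<in> core \<union> tight" using that by (auto simp: U0_def)
    then show ?thesis using \<rho>V by (auto simp: rep_def)
  qed
  have col0: "colors U0 L \<phi>0"
    unfolding colors_def
  proof (intro conjI ballI impI)
    fix v assume v: "v \<in> U0"
    show "\<phi>0 v \<in> L v"
    proof (cases "v \<in> ?Q")
      case True
      then show ?thesis using c[of v] by (simp add: \<phi>0_def good_def)
    next
      case False
      then have 1: "\<phi>' (\<rho> v) \<in> L (\<rho> v)" using \<rho>[of v] \<phi>'_list v by blast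
      have "L (\<rho> v) \<subseteq> L v"
      proof (cases "v \<in> gX ` tight")
        case True
        then show ?thesis using \<rho>X by (auto simp: tight_def)
      qed (simp add: \<rho>_def)
      then show ?thesis using 1 False by (auto simp: \<phi>0_def)
    qed
  next
    have mixed: "\<phi>0 u \<noteq> \<phi>0 v" if uv: "u \<in> U0" "v \<in> ?Q" "E u v" for u v
    proof -
      have u: "u \<in> core"
        using uv P_indep[of u v] gX_notP_adj[of _ v] tight_owners tight_P by (auto simp: U0_def)
      then have "u \<notin> ?Q" using core_V by blast
      moreover have "\<phi>' u \<notin> c ` nbhd ?Q u" using \<phi>'_list[of u] u by blast
      then have "\<phi>' u \<noteq> c v" using uv by auto
      ultimately show ?thesis using \<rho>V[of u] u uv(2) by (auto simp: \<phi>0_def)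
    qed
    fix u v assume uv: "u \<in> U0" "v \<in> U0" "E u v"
    consider "v \<in> ?Q" | "u \<in> ?Q" | "u \<notin> ?Q" "v \<notin> ?Q" by blast
    then show "\<phi>0 u \<noteq> \<phi>0 v"
    proof cases
      case 1
      then show ?thesis using mixed uv by blast
    next
      case 2
      then show ?thesis using mixed[OF uv(2) 2 sym[OF uv(3)]] by simp
    next
      case 3
      then have u: "\<rho> u \<in> core \<union> tight" "u \<in> rep (\<rho> u)" and v: "\<rho> v \<in> core \<union> tight" "v \<in> rep (\<rho> v)"
        using \<rho> uv by auto
      have "E' (\<rho> u) (\<rho> v)" unfolding E'_def using u(2) v(2) uv(3) by blast
      then show ?thesis using \<phi>'_adj[OF u(1) v(1)] 3 by (auto simp: \<phi>0_def)
    qed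
  qed
  have U0V: "U0 \<subseteq> V" using core_V tight_P PV gXV(1) tight_owners by (auto simp: U0_def)
  have PU0: "P \<subseteq> U0" by (auto simp: U0_def)
  let ?D = "\<lambda>p. insert (gX p) (gW p)"
  have DV: "?D p \<subseteq> V" if "p \<in> owners" for p
    using gadgetD(2,3)[OF gadget_own[OF that]] by blast
  have U0W: "U0 \<inter> gW p = {}" if p: "p \<in> owners" for p
  proof -
    have "core \<inter> gW p = {}" using p by (auto simp: core_def)
    moreover have "P \<inter> gW p = {}" using gadgetD(2)[OF gadget_own[OF p]] by blast
    moreover have "gX q \<notin> gW p" if "q \<in> tight" for q
      using gadgets_disjoint(2)[OF tight_owners[OF that] p] gadgetD(4)[OF gadget_own[OF p]] by auto
    ultimately show ?thesis using tight_P by (auto simp: U0_def)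
  qed
  have finO: "finite owners" using owners_P PV finite_subset[OF _ finV, of owners] by blast
  \<comment> \<open>The colours on \<open>U0\<close> stay fixed in the induction, so every owner
    keeps the colour from which its gadget can be completed.\<close>
  have "\<exists>\<phi>. colors (U0 \<union> (\<Union>p \<in> F. ?D p)) L \<phi> \<and> (\<forall>v \<in> U0. \<phi> v = \<phi>0 v)"
    if "F \<subseteq> owners" "finite F" for F
    using that(2,1)
  proof (induction F rule: finite_induct)
    case empty
    then show ?case using col0 by auto
  next
    case (insert p F)
    define U where "U = U0 \<union> (\<Union>q \<in> F. ?D q)"
    obtain \<phi> where \<phi>: "colors U L \<phi>" "\<forall>v \<in> U0. \<phi> v = \<phi>0 v"
      using insert by (auto simp: U_def)
    have po: "p \<in> owners" using insert by blast
    note g = gadget_own[OF po]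
    note gd = gadgetD[OF g]
    have pU0: "p \<in> U0" using PU0 gd(1) by blast
    have pU: "p \<in> U" using pU0 by (simp add: U_def)
    have UV: "U \<subseteq> V" using U0V DV insert.prems by (auto simp: U_def)
    have other: "?D q \<inter> gW p = {}" "gX p \<notin> ?D q" if "q \<in> F" for q
    proof -
      have "q \<in> owners" "q \<noteq> p" using that insert by auto
      then show "?D q \<inter> gW p = {}" "gX p \<notin> ?D q"
        using gadgets_disjoint[OF po, of q] gadgets_disjoint[OF _ po, of q] by auto
    qed
    have UW: "U \<inter> gW p = {}" using U0W[OF po] other(1) by (auto simp: U_def)
    have "\<exists>\<psi>. colors (U \<union> ?D p) L \<psi> \<and> (\<forall>v \<in> U. \<psi> v = \<phi> v)"
    proof (cases "p \<in> tight")
      case True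
      have xU0: "gX p \<in> U0" using True by (auto simp: U0_def)
      have "\<phi>0 p = \<phi>' p" "\<phi>0 (gX p) = \<phi>' p"
        using True \<rho>V[of p] \<rho>X[OF True] gd(3) by (auto simp: \<phi>0_def)
      then have eq: "\<phi> (gX p) = \<phi> p" using \<phi>(2) pU0 xU0 by simp
      have xU: "gX p \<in> U" using xU0 by (simp add: U_def)
      have cW: "clique (gW p)" using gd(6) clique_subset by blast
      have "colorable (gW p) (\<lambda>v. L v - \<phi> ` nbhd U v)"
      proof -
        \<comment> \<open>Because \<open>p\<close> and \<open>gX p\<close> share a colour,
          \<open>w\<close> keeps at least \<open>D - 1\<close> colours, one more than its degree in
          the clique \<open>gW p\<close>.\<close>
        have lt: "card (nbhd (gW p) w) < card (L w - \<phi> ` nbhd U w)" if w: "w \<in> gW p" for w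
        proof -
          have "nbhd U w \<subseteq> {p, gX p}"
          proof
            fix u assume "u \<in> nbhd U w"
            then have "u \<in> nbhd V w" "u \<notin> gW p" using UV UW by auto
            then show "u \<in> {p, gX p}" unfolding gadget_nbhd[OF g w] by blast
          qed
          then have sub: "\<phi> ` nbhd U w \<subseteq> {\<phi> p}" using eq by auto
          have "card (L w) = D" using LD gd(2) w by blast
          then have "D - 1 \<le> card (L w - {\<phi> p})"
            using diff_card_le_card_Diff[of "{\<phi> p}" "L w"] by simp
          also have "\<dots> \<le> card (L w - \<phi> ` nbhd U w)"
            using sub finite_L[of w] gd(2) w by (intro card_mono) auto
          finally show ?thesis using nbhd_clique[OF cW w] w gd(5,10) D4 by simp
        qed
        obtain w where w: "w \<in> gW p" using gd(11) by blast
        show ?thesis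
          by (rule greedy_conn[where r = w, OF gd(10) conn_clique[OF cW] w])
            (use lt w in \<open>simp_all add: less_imp_le\<close>)
      qed
      then obtain \<psi> where \<psi>: "colors (U \<union> gW p) L \<psi>" "\<And>v. v \<in> U \<Longrightarrow> \<psi> v = \<phi> v"
        by (rule extend_colors[OF \<phi>(1) UW]) blast
      have "U \<union> gW p = U \<union> ?D p" using xU by blast
      then have "colors (U \<union> ?D p) L \<psi>" using \<psi>(1) by simp
      then show ?thesis using \<psi>(2) by blast
    next
      case False
      have "gX p \<notin> gX ` tight"
      proof
        assume "gX p \<in> gX ` tight"
        then obtain q where "q \<in> tight" "gX p = gX q" by blast
        then show False using gadgets_disjoint(3)[OF po tight_owners, of q] False by blast
      qed
      then have "gX p \<notin> U0" using gXV[OF po] tight_P by (auto simp: U0_def)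
      then have xU: "U \<inter> ?D p = {}" using UW other(2) by (auto simp: U_def)
      have "\<phi> p = c p" using \<phi>(2) pU0 gd(1) False by (simp add: \<phi>0_def)
      then obtain w0 where w0: "w0 \<in> gW p"
        "\<phi> p \<notin> L w0 \<or> L (gX p) - \<phi> ` nbhd U (gX p) \<noteq> L w0 - {\<phi> p}"
        using c[OF gd(1)] po False unfolding good_def by (metis DiffI Diff_subset)
      have lst: "card (L v) = D" if "v \<in> ?D p" for v using LD[of v] gd(2,3) that by auto
      obtain \<psi> where "colors (U \<union> ?D p) L \<psi>" "\<And>v. v \<in> U \<Longrightarrow> \<psi> v = \<phi> v"
        by (rule gadget_extend[OF g UV xU pU \<phi>(1) lst w0]) blast+
      then show ?thesis by blast
    qed
    then obtain \<psi> where \<psi>: "colors (U \<union> ?D p) L \<psi>" "\<forall>v \<in> U. \<psi> v = \<phi> v" by blast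
    have "U \<union> ?D p = U0 \<union> (\<Union>q \<in> insert p F. ?D q)" by (auto simp: U_def)
    moreover have "\<psi> v = \<phi>0 v" if "v \<in> U0" for v using \<psi>(2) \<phi>(2) that by (simp add: U_def)
    ultimately show ?case using \<psi>(1) by auto
  qed
  from this[OF order.refl finO] have "colorable (U0 \<union> (\<Union>p \<in> owners. ?D p)) L"
    by (auto simp: colorable_def)
  moreover have "U0 \<union> (\<Union>p \<in> owners. ?D p) = V"
    using U0V DV by (auto simp: U0_def core_def)
  ultimately show ?thesis by simp
qed

end

section \<open>Symmetric digraphs\<close>

lemma ecard_geD:
  assumes "enat n \<le> ecard A"
  obtains B where "B \<subseteq> A" "card B = n"
proof (cases "finite A")
  case True
  then have "n \<le> card A" using assms by (simp add: ecard_def)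
  then show ?thesis using obtain_subset_with_card_n that by metis
next
  case False
  then show ?thesis using infinite_arbitrarily_large that by metis
qed

context graph
begin

section \<open>Short walks as bounds on distances\<close>

lemma graph_dist_le_length:
  assumes "awalk u p v"
  shows "graph_dist G u v \<le> length p"
proof -
  have "awalk_cost (\<lambda>_. 1) p = length p" by (induction p) auto
  then show ?thesis
    unfolding graph_dist_def using min_cost_le_walk_cost[OF assms, of "\<lambda>_. 1"] by simp
qed

lemma dominates_arc:
  assumes "u \<rightarrow>\<^bsub>G\<^esub> v"
  obtains e where "e \<in> arcs G" "tail G e = u" "head G e = v"
  using assms by (auto simp: arcs_ends_def arc_to_ends_def)

lemma dominates_verts: "u \<rightarrow>\<^bsub>G\<^esub> v \<Longrightarrow> u \<in> verts G \<and> v \<in> verts G"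
  by (auto simp: arcs_ends_def arc_to_ends_def)

lemma graph_dist_1: "u \<rightarrow>\<^bsub>G\<^esub> v \<Longrightarrow> graph_dist G u v \<le> 1"
proof -
  assume "u \<rightarrow>\<^bsub>G\<^esub> v"
  then obtain e where e: "e \<in> arcs G" "tail G e = u" "head G e = v" by (rule dominates_arc)
  then have "awalk u [e] v" by (auto simp: awalk_def)
  from graph_dist_le_length[OF this] show ?thesis by (simp add: one_ereal_def)
qed

lemma graph_dist_2: "u \<rightarrow>\<^bsub>G\<^esub> w \<Longrightarrow> w \<rightarrow>\<^bsub>G\<^esub> v \<Longrightarrow> graph_dist G u v \<le> 2"
proof -
  assume "u \<rightarrow>\<^bsub>G\<^esub> w" "w \<rightarrow>\<^bsub>G\<^esub> v"
  then obtain e f where "e \<in> arcs G" "tail G e = u" "head G e = w"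
    "f \<in> arcs G" "tail G f = w" "head G f = v" by (metis dominates_arc)
  then have "awalk u [e, f] v" by (auto simp: awalk_def)
  from graph_dist_le_length[OF this] show ?thesis by simp
qed

lemma graph_dist_3: "u \<rightarrow>\<^bsub>G\<^esub> w \<Longrightarrow> w \<rightarrow>\<^bsub>G\<^esub> z \<Longrightarrow> z \<rightarrow>\<^bsub>G\<^esub> v \<Longrightarrow> graph_dist G u v \<le> 3"
proof -
  assume "u \<rightarrow>\<^bsub>G\<^esub> w" "w \<rightarrow>\<^bsub>G\<^esub> z" "z \<rightarrow>\<^bsub>G\<^esub> v"
  then obtain e f g where "e \<in> arcs G" "tail G e = u" "head G e = w"
    "f \<in> arcs G" "tail G f = w" "head G f = z" "g \<in> arcs G" "tail G g = z" "head G g = v"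
    by (metis dominates_arc)
  then have "awalk u [e, f, g] v" by (auto simp: awalk_def)
  from graph_dist_le_length[OF this] show ?thesis by simp
qed

section \<open>Degrees, connectivity and cliques of the digraph\<close>

lemma simple_graph_dominates: "simple_graph (\<lambda>u v. u \<rightarrow>\<^bsub>G\<^esub> v)"
proof
  show "v \<rightarrow>\<^bsub>G\<^esub> u" if "u \<rightarrow>\<^bsub>G\<^esub> v" for u v
    using sym_arcs that by (auto simp: symmetric_def dest: symD)
  show "\<not> u \<rightarrow>\<^bsub>G\<^esub> u" for u
    using no_loops by (auto simp: arcs_ends_def arc_to_ends_def)
qed

sublocale S: simple_graph "\<lambda>u v. u \<rightarrow>\<^bsub>G\<^esub> v"
  by (rule simple_graph_dominates)

lemma out_degree_eq_card_nbhd: "out_degree G v = card (S.nbhd (verts G) v)"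
proof -
  have "inj_on (head G) (out_arcs G v)"
    by (rule inj_onI) (auto intro: no_multi_arcs simp: arc_to_ends_def)
  moreover have "head G ` out_arcs G v = S.nbhd (verts G) v"
  proof (intro equalityI subsetI)
    fix u assume "u \<in> head G ` out_arcs G v"
    then show "u \<in> S.nbhd (verts G) v"
      unfolding S.in_nbhd by (auto simp: arcs_ends_def arc_to_ends_def)
  next
    fix u assume "u \<in> S.nbhd (verts G) v"
    then obtain e where "e \<in> arcs G" "tail G e = v" "head G e = u"
      by (metis S.in_nbhd dominates_arc)
    then show "u \<in> head G ` out_arcs G v" by auto
  qed
  ultimately show ?thesis by (metis card_image out_degree_def)
qed

lemma degree_le_max: "v \<in> verts G \<Longrightarrow> card (S.nbhd (verts G) v) \<le> max_degree G"
  unfolding max_degree_def out_degree_eq_card_nbhd[symmetric] by (intro Max_ge) auto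

lemma conn_verts:
  assumes "connected G"
  shows "S.conn (verts G)"
  unfolding S.conn_def
proof (intro allI impI)
  fix X assume X: "S.closed_in (verts G) X" "X \<noteq> {}"
  have XV: "X \<subseteq> verts G" using S.closed_in_subset[OF X(1)] .
  obtain u where u: "u \<in> X" using X(2) by blast
  have "strongly_connected G"
    using assms by (intro symmetric_connected_imp_strongly_connected sym_arcs)
  then have reach: "u \<rightarrow>\<^sup>* v" if "v \<in> verts G" for v
    using that u XV by (auto simp: strongly_connected_def)
  have "v \<in> X" if "u \<rightarrow>\<^sup>* v" for v
    using that
  proof (induction rule: reachable_induct)
    case base
    show ?case using u .
  next
    case (step x y)
    then show ?case using S.closed_inD[OF X(1), of x y] dominates_verts by blast
  qed
  then show "X = verts G" using reach XV by blast
qed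

text \<open>Inside such a clique every vertex already has maximum degree, so no edge leaves it. By
  connectivity it is the whole graph, which is then complete.\<close>

lemma no_full_clique:
  assumes "connected G" "\<not> complete_graph G" "T \<subseteq> verts G" "S.clique T"
  shows "card T \<noteq> max_degree G + 1"
proof
  assume cT: "card T = max_degree G + 1"
  have finT: "finite T" using finite_subset[OF assms(3)] by simp
  have sub: "S.nbhd (verts G) v = T - {v}" if v: "v \<in> T" for v
  proof (rule card_seteq[symmetric])
    show "T - {v} \<subseteq> S.nbhd (verts G) v"
      using S.nbhd_clique[OF assms(4) v] S.nbhd_mono[OF assms(3), of v] by simp
    show "card (S.nbhd (verts G) v) \<le> card (T - {v})"
      using degree_le_max[of v] assms(3) v cT finT by auto
  qed simp
  have "S.closed_in (verts G) T"
  proof (rule S.closed_inI[OF assms(3)])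
    fix u v assume "u \<in> T" "v \<in> verts G" "u \<rightarrow>\<^bsub>G\<^esub> v"
    then have "v \<in> S.nbhd (verts G) u" by simp
    then show "v \<in> T" using sub[OF \<open>u \<in> T\<close>] by simp
  qed
  moreover have "T \<noteq> {}" using cT by auto
  ultimately have T: "T = verts G" using S.connD[OF conn_verts[OF assms(1)]] by blast
  have "arcs_ends G = {(u, v). (u, v) \<in> verts G \<times> verts G \<and> u \<noteq> v}"
  proof (intro equalityI subsetI)
    fix e assume e: "e \<in> arcs_ends G"
    obtain u v where uv: "e = (u, v)" by (cases e)
    then have "u \<rightarrow>\<^bsub>G\<^esub> v" using e by simp
    then show "e \<in> {(u, v). (u, v) \<in> verts G \<times> verts G \<and> u \<noteq> v}"
      using dominates_verts[of u v] S.irrefl[of u] uv by auto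
  next
    fix e assume "e \<in> {(u, v). (u, v) \<in> verts G \<times> verts G \<and> u \<noteq> v}"
    then show "e \<in> arcs_ends G" using assms(4) unfolding T S.clique_def by auto
  qed
  then have "complete_digraph (card (verts G)) G"
    using graph_axioms by (simp add: complete_digraph_def)
  then show False using assms(2) by (auto simp: complete_graph_def)
qed

lemma L_colorableI:
  assumes "S.colorable (verts G) L0" "\<And>v. v \<in> verts G \<Longrightarrow> L0 v \<subseteq> L v"
  shows "L_colorable G L"
proof -
  obtain \<phi> where "S.colors (verts G) L0 \<phi>" using assms(1) by (auto simp: S.colorable_def)
  then have "L_coloring G L \<phi>"
    using assms(2) dominates_verts unfolding L_coloring_def proper_coloring_def S.colors_def by blast
  then show ?thesis unfolding L_colorable_def by blast
qed

lemma brooks_graph_verts: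
  assumes "connected G" "4 \<le> max_degree G" "\<not> complete_graph G" "P \<subseteq> verts G"
    and dist: "\<forall>u \<in> P. \<forall>v \<in> P. u \<noteq> v \<longrightarrow> 3 \<le> graph_dist G u v"
  shows "brooks_graph (\<lambda>u v. u \<rightarrow>\<^bsub>G\<^esub> v) (max_degree G) (verts G) P"
proof
  show "\<not> p \<rightarrow>\<^bsub>G\<^esub> q" if pq: "p \<in> P" "q \<in> P" for p q
  proof
    assume a: "p \<rightarrow>\<^bsub>G\<^esub> q"
    then have "p \<noteq> q" using S.irrefl by blast
    then have "3 \<le> graph_dist G p q" using dist pq by blast
    from order.trans[OF this graph_dist_1[OF a]] show False by simp
  qed
  show "p = q" if pq: "v \<in> verts G" "p \<in> P" "q \<in> P" "v \<rightarrow>\<^bsub>G\<^esub> p" "v \<rightarrow>\<^bsub>G\<^esub> q" for v p q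
  proof (rule ccontr)
    assume "p \<noteq> q"
    then have "3 \<le> graph_dist G p q" using dist pq by blast
    from order.trans[OF this graph_dist_2[OF S.sym[OF pq(4)] pq(5)]] show False by simp
  qed
qed (use assms degree_le_max no_full_clique in auto)

end

theorem theorem2p3:
  fixes G :: "('a, 'b) pre_digraph"
    and P :: "'a set"
    and L :: "'a \<Rightarrow> nat set"
  assumes "graph G"
    and "Digraph_Component.connected G"
    and "max_degree G \<ge> 4"
    and "\<not> complete_graph G"
    and "P \<subseteq> verts G"
    and "list_assignment G L"
    and "\<forall>v \<in> verts G - P. ecard (L v) \<ge> enat (max_degree G)"
    and "((\<forall>v \<in> P. ecard (L v) \<ge> 2) \<and>
          (\<forall>u \<in> P. \<forall>v \<in> P. u \<noteq> v \<longrightarrow> graph_dist G u v \<ge> 4)) \<or>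
         ((\<forall>v \<in> P. ecard (L v) \<ge> 3) \<and>
          (\<forall>u \<in> P. \<forall>v \<in> P. u \<noteq> v \<longrightarrow> graph_dist G u v \<ge> 3))"
  shows "L_colorable G L"
proof -
  interpret graph G by fact
  let ?D = "max_degree G"
  \<comment> \<open>Possibly infinite lists are cut down to finite ones of the exact sizes for which
    the colouring lemmas are stated.\<close>
  have shrink: "\<exists>L0. (\<forall>v \<in> verts G. L0 v \<subseteq> L v \<and> card (L0 v) = (if v \<in> P then k else ?D))"
    if k: "\<forall>v \<in> P. enat k \<le> ecard (L v)" for k
  proof (rule bchoice, rule ballI)
    fix v assume v: "v \<in> verts G"
    have "enat (if v \<in> P then k else ?D) \<le> ecard (L v)" using k assms(7) v by simp
    then show "\<exists>B. B \<subseteq> L v \<and> card B = (if v \<in> P then k else ?D)" by (metis ecard_geD)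
  qed
  from assms(8) show ?thesis
  proof (elim disjE conjE)
    assume two: "\<forall>v \<in> P. ecard (L v) \<ge> 2"
      and dist: "\<forall>u \<in> P. \<forall>v \<in> P. u \<noteq> v \<longrightarrow> graph_dist G u v \<ge> 4"
    have dist3: "\<forall>u \<in> P. \<forall>v \<in> P. u \<noteq> v \<longrightarrow> 3 \<le> graph_dist G u v"
    proof (intro ballI impI)
      fix u v assume "u \<in> P" "v \<in> P" "u \<noteq> v"
      then have "4 \<le> graph_dist G u v" using dist by blast
      moreover have "(3 :: ereal) \<le> 4" by simp
      ultimately show "3 \<le> graph_dist G u v" by (rule order.trans[rotated])
    qed
    interpret B: brooks_graph "\<lambda>u v. u \<rightarrow>\<^bsub>G\<^esub> v" ?D "verts G" P
      by (rule brooks_graph_verts[OF assms(2-5) dist3])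
    have "\<forall>v \<in> P. enat 2 \<le> ecard (L v)" using two by (simp add: numeral_eq_enat)
    then obtain L0 where L0: "\<forall>v \<in> verts G. L0 v \<subseteq> L v \<and> card (L0 v) = (if v \<in> P then 2 else ?D)"
      using shrink by blast
    interpret F: brooks_far "\<lambda>u v. u \<rightarrow>\<^bsub>G\<^esub> v" ?D "verts G" P L0
    proof
      show "card (L0 v) = ?D" if "v \<in> verts G - P" for v using L0 that by simp
      show "2 \<le> card (L0 p)" if "p \<in> P" for p using L0 that assms(5) by auto
      show "p = q" if pq: "p \<in> P" "q \<in> P" "p \<rightarrow>\<^bsub>G\<^esub> v" "v \<rightarrow>\<^bsub>G\<^esub> w" "w \<rightarrow>\<^bsub>G\<^esub> q" for v w p q
      proof (rule ccontr)
        assume "p \<noteq> q"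
        then have "4 \<le> graph_dist G p q" using dist pq by blast
        from order.trans[OF this graph_dist_3[OF pq(3-5)]] show False by simp
      qed
    qed
    show ?thesis using L_colorableI[OF F.colorable_far] L0 by blast
  next
    assume three: "\<forall>v \<in> P. ecard (L v) \<ge> 3"
      and dist: "\<forall>u \<in> P. \<forall>v \<in> P. u \<noteq> v \<longrightarrow> graph_dist G u v \<ge> 3"
    have "\<forall>v \<in> P. enat 3 \<le> ecard (L v)" using three by (simp add: numeral_eq_enat)
    then obtain L0 where L0: "\<forall>v \<in> verts G. L0 v \<subseteq> L v \<and> card (L0 v) = (if v \<in> P then 3 else ?D)"
      using shrink by blast
    have "S.colorable (verts G) L0"
      using L0 assms(5) by (intro S.colorable_three[OF brooks_graph_verts[OF assms(2-5) dist]]) auto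
    then show ?thesis using L_colorableI L0 by blast
  qed
qed

end
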